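(* Let $P$ be a poset that is graded with a corank function and let $F$ be a presheaf on $P$. Then for every $n\geq 0$ there are natural isomorphisms $$C^n(P;F)\cong\prod_{|x|=n}\widetilde{HS}^{\,n-1}(P_{>x};\Delta F(x)),$$ where the product is over the elements $x\in P$ of corank $n$.
   Context: Posets and presheaves. A poset $P$ is viewed as a category with a unique morphism $x\to y$ iff $x\le y$. A presheaf on $P$ is a functor $F:P^{\mathrm{op}}\to\mathbf{Ab}$; write $F^y_x:F(y)\to F(x)$ for the map induced by $x\le y$. A presheaf on $P$ restricts to a presheaf, also written $F$, on any subposet. For an abelian group $A$, $\Delta A$ is the constant presheaf with value $A$ and identity maps. Nerve and cochains. $N^nP$ is the set of $n$-simplices $\sigma=(\sigma_n\le\cdots\le\sigma_0)$ in $P$; the face map $d_i$ deletes $\sigma_i$. Let $S^n(P;F)=\prod_{\sigma\in N^nP}F(\sigma_n)$ and write $s\cdot\sigma\in F(\sigma_n)$ for the $\sigma$-component of $s$. The differential $d:S^{n-1}(P;F)\to S^n(P;F)$ is $$ds\cdot\sigma=\sum_{i=0}^{n-1}(-1)^i s\cdot d_i\sigma+(-1)^nF^{\sigma_{n-1}}_{\sigma_n}(s\cdot d_n\sigma).$$ Put $HS^*(P;F)=H(S^*(P;F),d)$. By convention $S^*(\varnothing;F)=0$. Reduced cohomology. For an abelian group $A$, $\widetilde S^*(P;\Delta A)$ is $S^*(P;\Delta A)$ augmented by $A$ in degree $-1$, with $d^{-1}:A\to S^0(P;\Delta A)$ the diagonal map $d^{-1}a\cdot\sigma=a$; its cohomology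 is $\widetilde{HS}^*(P;\Delta A)$ (so $\widetilde{HS}^*(\varnothing;\Delta A)$ is $A$ in degree $-1$ and $0$ otherwise). Relative cohomology. For a subposet $Q\subseteq P$, $S^*(P,Q;F)$ is the kernel of the restriction map $S^*(P;F)\to S^*(Q;F)$, i.e. the cochains $s$ with $s\cdot\sigma=0$ for all $\sigma\in N^*Q$; $HS^*(P,Q;F)$ is its cohomology, and $S^*(P,\varnothing;F)=S^*(P;F)$. Graded posets. $x\prec y$ means $x<y$ and there is no $z$ with $x<z<y$. $P$ is graded if there is a rank function $\mathrm{rk}:P\to\mathbb Z$ such that $x<y$ implies $\mathrm{rk}(x)<\mathrm{rk}(y)$, and $x\prec y$ implies $\mathrm{rk}(y)=\mathrm{rk}(x)+1$. "Graded with a corank function" means: a rank function is fixed which is bounded above, with maximum $r$, and the corank is $|x|=r-\mathrm{rk}(x)\ge 0$. Let $P^k=\{x\in P: |x|\le k\}$ (so $P^k=\varnothing$ for $k<0$), and $P_{>x}=\{y\in P: y>x\}$. Cellular cochains. $C^n(P;F)=HS^n(P^n,P^{n-1};F)$. "Natural" means natural in the presheaf $F$. *)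

theory Defs
  imports Complex_Main "HOL-Algebra.FiniteProduct" "HOL-Algebra.Product_Groups"
begin

text \<open>
  Posets are subsets of a type of class \<^class>\<open>order\<close> with the induced order, so that subposets are
  subsets. Abelian groups are commutative groups of HOL-Algebra and are written multiplicatively;
  the values of one presheaf are groups on possibly different carriers inside one type.
\<close>

subsection \<open>Presheaves\<close>

text \<open>\<open>res F x y\<close>, for \<open>x \<le> y\<close>, is the map from \<open>F(y)\<close> to \<open>F(x)\<close>.\<close>

record ('a, 'b) presheaf =
  obj :: "'a \<Rightarrow> 'b monoid"
  res :: "'a \<Rightarrow> 'a \<Rightarrow> 'b \<Rightarrow> 'b"

definition presheaf_on :: "'a::order set \<Rightarrow> ('a, 'b) presheaf \<Rightarrow> bool" where
  "presheaf_on P F \<longleftrightarrow>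
     (\<forall>x\<in>P. comm_group (obj F x)) \<and>
     (\<forall>x\<in>P. \<forall>y\<in>P. x \<le> y \<longrightarrow> res F x y \<in> hom (obj F y) (obj F x)) \<and>
     (\<forall>x\<in>P. \<forall>a\<in>carrier (obj F x). res F x x a = a) \<and>
     (\<forall>x\<in>P. \<forall>y\<in>P. \<forall>z\<in>P. x \<le> y \<longrightarrow> y \<le> z \<longrightarrow>
        (\<forall>a\<in>carrier (obj F z). res F x y (res F y z a) = res F x z a))"

definition presheaf_hom ::
    "'a::order set \<Rightarrow> ('a, 'b) presheaf \<Rightarrow> ('a, 'b) presheaf \<Rightarrow> ('a \<Rightarrow> 'b \<Rightarrow> 'b) \<Rightarrow> bool" where
  "presheaf_hom P F G \<phi> \<longleftrightarrow>
     (\<forall>x\<in>P. \<phi> x \<in> hom (obj F x) (obj G x)) \<and>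
     (\<forall>x\<in>P. \<forall>y\<in>P. x \<le> y \<longrightarrow>
        (\<forall>a\<in>carrier (obj F y). \<phi> x (res F x y a) = res G x y (\<phi> y a)))"

definition const_presheaf :: "'b monoid \<Rightarrow> ('a, 'b) presheaf" where
  "const_presheaf A = \<lparr>obj = (\<lambda>_. A), res = (\<lambda>_ _ a. a)\<rparr>"

subsection \<open>Cochain complexes and their cohomology\<close>

text \<open>The differential \<open>dif K n\<close> goes from degree \<open>n\<close> to degree \<open>n + 1\<close>.\<close>

record 'c cochain_complex =
  grp :: "int \<Rightarrow> 'c monoid"
  dif :: "int \<Rightarrow> 'c \<Rightarrow> 'c"

definition cocycles :: "'c cochain_complex \<Rightarrow> int \<Rightarrow> 'c set" where
  "cocycles K n = kernel (grp K n) (grp K (n + 1)) (dif K n)"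

definition coboundaries :: "'c cochain_complex \<Rightarrow> int \<Rightarrow> 'c set" where
  "coboundaries K n = dif K (n - 1) ` carrier (grp K (n - 1))"

definition cohomology :: "'c cochain_complex \<Rightarrow> int \<Rightarrow> 'c set monoid" where
  "cohomology K n = (grp K n)\<lparr>carrier := cocycles K n\<rparr> Mod coboundaries K n"

text \<open>
  Elements of the cohomology are cosets. The image \<open>f ` c\<close> of a coset under a cochain map \<open>f\<close> into
  \<open>L\<close> lies in a unique coset of the coboundaries of \<open>L\<close>, which is the product set below.
\<close>

definition cohomology_map ::
    "'c cochain_complex \<Rightarrow> int \<Rightarrow> ('c \<Rightarrow> 'c) \<Rightarrow> 'c set \<Rightarrow> 'c set" where
  "cohomology_map L n f c = coboundaries L n <#>\<^bsub>grp L n\<^esub> (f ` c)"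

subsection \<open>Cochains of a poset\<close>

text \<open>
  The simplex \<open>\<sigma>\<^sub>n \<le> \<dots> \<le> \<sigma>\<^sub>0\<close> is the list \<open>[\<sigma>\<^sub>0, \<dots>, \<sigma>\<^sub>n]\<close>. There are no simplices in negative
  degrees, so the cochain groups there, being products over the empty set, are trivial.
\<close>

definition nerve :: "'a::order set \<Rightarrow> int \<Rightarrow> 'a list set" where
  "nerve P n = {\<sigma>. \<sigma> \<noteq> [] \<and> int (length \<sigma>) = n + 1 \<and> set \<sigma> \<subseteq> P \<and> sorted_wrt (\<ge>) \<sigma>}"

definition face :: "nat \<Rightarrow> 'a list \<Rightarrow> 'a list" where
  "face i \<sigma> = take i \<sigma> @ drop (Suc i) \<sigma>"

definition cochains :: "'a::order set \<Rightarrow> ('a, 'b) presheaf \<Rightarrow> int \<Rightarrow> ('a list \<Rightarrow> 'b) monoid" where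
  "cochains P F n = product_group (nerve P n) (\<lambda>\<sigma>. obj F (last \<sigma>))"

definition differential ::
    "'a::order set \<Rightarrow> ('a, 'b) presheaf \<Rightarrow> int \<Rightarrow> ('a list \<Rightarrow> 'b) \<Rightarrow> ('a list \<Rightarrow> 'b)" where
  "differential P F n s =
     (if n < 0 then \<one>\<^bsub>cochains P F (n + 1)\<^esub>
      else (\<lambda>\<sigma>\<in>nerve P (n + 1).
        let m = nat (n + 1); G = obj F (\<sigma> ! m) in
          (\<Otimes>\<^bsub>G\<^esub>i\<in>{..<m}. s (face i \<sigma>) [^]\<^bsub>G\<^esub> ((-1) ^ i :: int)) \<otimes>\<^bsub>G\<^esub>
          res F (\<sigma> ! m) (\<sigma> ! (m - 1)) (s (face m \<sigma>)) [^]\<^bsub>G\<^esub> ((-1) ^ m :: int)))"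

definition cochain_cx ::
    "'a::order set \<Rightarrow> ('a, 'b) presheaf \<Rightarrow> ('a list \<Rightarrow> 'b) cochain_complex" where
  "cochain_cx P F = \<lparr>grp = cochains P F, dif = differential P F\<rparr>"

text \<open>The relative cochains are the kernel of the restriction map to the subposet \<open>Q\<close>.\<close>

definition rel_cochain_cx ::
    "'a::order set \<Rightarrow> 'a set \<Rightarrow> ('a, 'b) presheaf \<Rightarrow> ('a list \<Rightarrow> 'b) cochain_complex" where
  "rel_cochain_cx P Q F =
     \<lparr>grp = (\<lambda>n. (cochains P F n)
        \<lparr>carrier := kernel (cochains P F n) (cochains Q F n) (\<lambda>s. restrict s (nerve Q n))\<rparr>),
      dif = differential P F\<rparr>"

text \<open>
  For the augmented complex the empty list serves as the only simplex of degree \<open>-1\<close>: the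
  coefficient group \<open>A\<close> in that degree appears as the group of functions from \<open>{[]}\<close> to \<open>A\<close>.
\<close>

definition aug_nerve :: "'a::order set \<Rightarrow> int \<Rightarrow> 'a list set" where
  "aug_nerve P n = (if n = -1 then {[]} else nerve P n)"

definition red_cochains :: "'a::order set \<Rightarrow> 'b monoid \<Rightarrow> int \<Rightarrow> ('a list \<Rightarrow> 'b) monoid" where
  "red_cochains P A n = product_group (aug_nerve P n) (\<lambda>_. A)"

definition red_differential ::
    "'a::order set \<Rightarrow> 'b monoid \<Rightarrow> int \<Rightarrow> ('a list \<Rightarrow> 'b) \<Rightarrow> ('a list \<Rightarrow> 'b)" where
  "red_differential P A n s =
     (if n < -1 then \<one>\<^bsub>red_cochains P A (n + 1)\<^esub>
      else if n = -1 then (\<lambda>\<sigma>\<in>nerve P 0. s [])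
      else differential P (const_presheaf A) n s)"

definition red_cochain_cx ::
    "'a::order set \<Rightarrow> 'b monoid \<Rightarrow> ('a list \<Rightarrow> 'b) cochain_complex" where
  "red_cochain_cx P A = \<lparr>grp = red_cochains P A, dif = red_differential P A\<rparr>"

abbreviation rel_cohomology ::
    "'a::order set \<Rightarrow> 'a set \<Rightarrow> ('a, 'b) presheaf \<Rightarrow> int \<Rightarrow> ('a list \<Rightarrow> 'b) set monoid" where
  "rel_cohomology P Q F n \<equiv> cohomology (rel_cochain_cx P Q F) n"

abbreviation red_cohomology ::
    "'a::order set \<Rightarrow> 'b monoid \<Rightarrow> int \<Rightarrow> ('a list \<Rightarrow> 'b) set monoid" where
  "red_cohomology P A n \<equiv> cohomology (red_cochain_cx P A) n"

text \<open>
  The induced maps: \<open>\<phi>\<close> is a morphism of presheaves into \<open>G\<close>, and \<open>h\<close> is a homomorphism of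
  coefficient groups into \<open>B\<close>.
\<close>

definition rel_cohomology_map ::
    "'a::order set \<Rightarrow> 'a set \<Rightarrow> ('a, 'b) presheaf \<Rightarrow> int \<Rightarrow> ('a \<Rightarrow> 'b \<Rightarrow> 'b) \<Rightarrow>
     ('a list \<Rightarrow> 'b) set \<Rightarrow> ('a list \<Rightarrow> 'b) set" where
  "rel_cohomology_map P Q G n \<phi> =
     cohomology_map (rel_cochain_cx P Q G) n (\<lambda>s. \<lambda>\<sigma>\<in>nerve P n. \<phi> (last \<sigma>) (s \<sigma>))"

definition red_cohomology_map ::
    "'a::order set \<Rightarrow> 'b monoid \<Rightarrow> int \<Rightarrow> ('b \<Rightarrow> 'b) \<Rightarrow>
     ('a list \<Rightarrow> 'b) set \<Rightarrow> ('a list \<Rightarrow> 'b) set" where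
  "red_cohomology_map P B n h =
     cohomology_map (red_cochain_cx P B) n (\<lambda>s. \<lambda>\<sigma>\<in>aug_nerve P n. h (s \<sigma>))"

subsection \<open>Graded posets and cellular cochains\<close>

definition covered_in :: "'a::order set \<Rightarrow> 'a \<Rightarrow> 'a \<Rightarrow> bool" where
  "covered_in P x y \<longleftrightarrow> x \<in> P \<and> y \<in> P \<and> x < y \<and> \<not> (\<exists>z\<in>P. x < z \<and> z < y)"

definition rank_function :: "'a::order set \<Rightarrow> ('a \<Rightarrow> int) \<Rightarrow> bool" where
  "rank_function P rk \<longleftrightarrow>
     (\<forall>x\<in>P. \<forall>y\<in>P. x < y \<longrightarrow> rk x < rk y) \<and>
     (\<forall>x y. covered_in P x y \<longrightarrow> rk y = rk x + 1)"

text \<open>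
  The supremum of a nonempty set of integers that is bounded above is its maximum; if \<open>P\<close> is empty,
  the value of the supremum plays no role.
\<close>

definition corank :: "'a::order set \<Rightarrow> ('a \<Rightarrow> int) \<Rightarrow> 'a \<Rightarrow> int" where
  "corank P rk x = (SUP y\<in>P. rk y) - rk x"

definition corank_le :: "'a::order set \<Rightarrow> ('a \<Rightarrow> int) \<Rightarrow> int \<Rightarrow> 'a set" where
  "corank_le P rk k = {x \<in> P. corank P rk x \<le> k}"

definition strictly_above :: "'a::order set \<Rightarrow> 'a \<Rightarrow> 'a set" where
  "strictly_above P x = {y \<in> P. x < y}"

definition cellular_cochains ::
    "'a::order set \<Rightarrow> ('a \<Rightarrow> int) \<Rightarrow> ('a, 'b) presheaf \<Rightarrow> int \<Rightarrow> ('a list \<Rightarrow> 'b) set monoid" where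
  "cellular_cochains P rk F n =
     rel_cohomology (corank_le P rk n) (corank_le P rk (n - 1)) F n"

definition cellular_cochains_map ::
    "'a::order set \<Rightarrow> ('a \<Rightarrow> int) \<Rightarrow> ('a, 'b) presheaf \<Rightarrow> int \<Rightarrow> ('a \<Rightarrow> 'b \<Rightarrow> 'b) \<Rightarrow>
     ('a list \<Rightarrow> 'b) set \<Rightarrow> ('a list \<Rightarrow> 'b) set" where
  "cellular_cochains_map P rk G n \<phi> =
     rel_cohomology_map (corank_le P rk n) (corank_le P rk (n - 1)) G n \<phi>"

end

theory Submission
  imports Defs
begin

text \<open>
  An element \<open>x\<close> of corank \<open>n\<close> is minimal among the elements of corank at most \<open>n\<close>, and everything
  strictly above it has corank at most \<open>n - 1\<close>. More generally, let \<open>Q \<subseteq> P\<close> be such that whatever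
  lies strictly above an element of \<open>P\<close> belongs to \<open>Q\<close>. A simplex of \<open>P\<close> that is not a
  simplex of \<open>Q\<close> then has the form \<open>\<tau> @ [x, \<dots>, x]\<close> with \<open>x \<in> P - Q\<close> and \<open>\<tau>\<close> a possibly empty simplex
  of elements strictly above \<open>x\<close>. A relative cochain \<open>s\<close> lives on these simplices and takes its
  values in \<open>F x\<close>. A face of such a simplex either ends in \<open>x\<close> again or lies in \<open>Q\<close>, where \<open>s\<close>
  vanishes; hence the restriction maps of \<open>F\<close> do not influence the differential, and the relative
  complex is the product over \<open>x\<close> of the relative complexes, with constant coefficients \<open>F x\<close>, of the
  elements above \<open>x\<close> modulo those strictly above \<open>x\<close>. The former have the least element \<open>x\<close>, so their
  reduced cohomology is trivial and the relative one is the reduced cohomology of the latter, shifted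
  by one degree.

  This shift is realised by explicit maps, without long exact sequences. Call the set of elements
  strictly above \<open>x\<close> the link of \<open>x\<close>. The restriction to the link sends
  \<open>s\<close> to \<open>\<tau> \<mapsto> s (\<tau> @ [x])\<close>. It is a cochain map (\<open>link_cochain_dif\<close>), including the degree in
  which \<open>\<tau>\<close> is empty, and the extension by zero to simplices with a repeated \<open>x\<close>, the cone, is a
  section of it that is also a cochain map (\<open>cone_cochain_dif\<close>). A cocycle whose restrictions to all
  links vanish is a coboundary, the contraction being the repetition of the last vertex
  (\<open>link_kernel_acyclic\<close>). So every family of cocycles on the links comes from the cocycle that is
  its cone, and a cocycle whose restrictions are coboundaries is one itself, since it differs from a
  cone over coboundaries by a cocycle with vanishing restrictions
  (\<open>link_reflects_coboundaries\<close>). The isomorphism is natural since it is induced by a map that only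
  reindexes cochains.
\<close>

section \<open>Cohomology classes\<close>

lemma comm_group_subgroup:
  assumes "comm_group G" "subgroup H G"
  shows "comm_group (G\<lparr>carrier := H\<rparr>)"
proof -
  interpret G: comm_group G by fact
  interpret H: group "G\<lparr>carrier := H\<rparr>"
    using assms(2) by (simp add: G.subgroup_imp_group)
  show ?thesis
    by (rule H.group_comm_groupI) (use G.m_comm subgroup.subset[OF assms(2)] in auto)
qed

lemma (in comm_group) rcoset_eq_iff:
  assumes "subgroup B G" "a \<in> carrier G" "b \<in> carrier G"
  shows "B #> a = B #> b \<longleftrightarrow> a \<otimes> inv b \<in> B"
  using assms subgroup.rcos_module[OF assms(1) is_group, of b a] rcos_self repr_independence
  by (metis (no_types))

text \<open>
  What makes the cosets of the coboundaries behave like elements of an abelian group is that the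
  differentials are homomorphisms of abelian groups.
\<close>

locale group_sequence =
  fixes K :: "'c cochain_complex"
  assumes comm_group_grp: "comm_group (grp K n)"
    and dif_hom: "dif K n \<in> hom (grp K n) (grp K (n + 1))"
begin

lemma dif_group_hom: "group_hom (grp K n) (grp K (n + 1)) (dif K n)"
  by (simp add: group_hom_def group_hom_axioms_def dif_hom comm_group.axioms(2) comm_group_grp)

lemma cocycles_subgroup: "subgroup (cocycles K n) (grp K n)"
  unfolding cocycles_def by (rule group_hom.subgroup_kernel[OF dif_group_hom])

lemma coboundaries_subgroup: "subgroup (coboundaries K n) (grp K n)"
  using group_hom.img_is_subgroup[OF dif_group_hom, of "n - 1"] by (simp add: coboundaries_def)

lemma coboundaries_normal: "coboundaries K n \<lhd> grp K n"
  by (rule comm_group.subgroup_imp_normal[OF comm_group_grp coboundaries_subgroup])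

end

text \<open>
  Classes are multiplied, compared and mapped by means of representatives, which reduces every
  statement about cohomology and induced maps to one about cochains.
\<close>

definition cohomology_class :: "'c cochain_complex \<Rightarrow> int \<Rightarrow> 'c \<Rightarrow> 'c set" where
  "cohomology_class K n z = coboundaries K n #>\<^bsub>grp K n\<^esub> z"

context group_sequence
begin

lemma cocycles_carrier: "z \<in> cocycles K n \<Longrightarrow> z \<in> carrier (grp K n)"
  by (simp add: cocycles_def kernel_def)

lemma carrier_cohomology:
  "carrier (cohomology K n) = cohomology_class K n ` cocycles K n"
  by (simp add: cohomology_def cohomology_class_def[abs_def] carrier_FactGroup)

lemma mult_cohomology:
  assumes "z \<in> cocycles K n" "w \<in> cocycles K n"
  shows "cohomology_class K n z \<otimes>\<^bsub>cohomology K n\<^esub> cohomology_class K n w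
       = cohomology_class K n (z \<otimes>\<^bsub>grp K n\<^esub> w)"
  using normal.rcos_sum[OF coboundaries_normal] assms cocycles_carrier
  by (simp add: cohomology_def cohomology_class_def)

lemma cohomology_class_eq_iff:
  assumes "z \<in> carrier (grp K n)" "w \<in> carrier (grp K n)"
  shows "cohomology_class K n z = cohomology_class K n w
     \<longleftrightarrow> z \<otimes>\<^bsub>grp K n\<^esub> inv\<^bsub>grp K n\<^esub> w \<in> coboundaries K n"
  unfolding cohomology_class_def
  by (rule comm_group.rcoset_eq_iff[OF comm_group_grp coboundaries_subgroup assms])

lemma coboundaries_image:
  assumes "\<And>s. s \<in> carrier (grp K (n - 1)) \<Longrightarrow> g s \<in> carrier (grp L (m - 1))"
    and "\<And>s. s \<in> carrier (grp K (n - 1)) \<Longrightarrow> f (dif K (n - 1) s) = dif L (m - 1) (g s)"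
  shows "f ` coboundaries K n \<subseteq> coboundaries L m"
  using assms by (auto simp: coboundaries_def)

text \<open>
  The product set in the definition of the induced map absorbs the image of the coboundaries and
  leaves the coset of the image of any representative. The degrees of source and target may differ,
  since the maps to links lower the degree by one.
\<close>

lemma cohomology_map_class:
  assumes L: "group_sequence L"
    and f: "f \<in> hom (grp K n) (grp L m)" "f ` coboundaries K n \<subseteq> coboundaries L m"
    and z: "z \<in> carrier (grp K n)"
  shows "cohomology_map L m f (cohomology_class K n z) = cohomology_class L m (f z)"
proof -
  interpret L: group_sequence L by fact
  interpret G: comm_group "grp L m" by (rule L.comm_group_grp)
  have sub: "\<And>b. b \<in> coboundaries K n \<Longrightarrow> b \<in> carrier (grp K n)"
    using subgroup.subset[OF coboundaries_subgroup] by blast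
  have subL: "\<And>b. b \<in> coboundaries L m \<Longrightarrow> b \<in> carrier (grp L m)"
    using subgroup.subset[OF L.coboundaries_subgroup] by blast
  have fz: "f z \<in> carrier (grp L m)" using f z by (auto simp: hom_def)
  have one: "\<one>\<^bsub>grp K n\<^esub> \<in> coboundaries K n"
    by (rule subgroup.one_closed[OF coboundaries_subgroup])
  have f1: "f \<one>\<^bsub>grp K n\<^esub> = \<one>\<^bsub>grp L m\<^esub>"
    using hom_one[OF f(1)] comm_group.axioms(2)[OF comm_group_grp] G.is_group by blast
  have fb: "f (b \<otimes>\<^bsub>grp K n\<^esub> z) = f b \<otimes>\<^bsub>grp L m\<^esub> f z" if "b \<in> coboundaries K n" for b
    using f(1) sub[OF that] z by (simp add: hom_mult)
  show ?thesis
  proof (intro equalityI subsetI)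
    fix y assume "y \<in> cohomology_map L m f (cohomology_class K n z)"
    then obtain b' b where b: "b' \<in> coboundaries L m" "b \<in> coboundaries K n"
      and y: "y = b' \<otimes>\<^bsub>grp L m\<^esub> f (b \<otimes>\<^bsub>grp K n\<^esub> z)"
      by (auto simp: cohomology_map_def cohomology_class_def set_mult_def r_coset_def)
    have "f b \<in> coboundaries L m" using b f by blast
    moreover from this have "y = (b' \<otimes>\<^bsub>grp L m\<^esub> f b) \<otimes>\<^bsub>grp L m\<^esub> f z"
      unfolding y fb[OF b(2)] using b(1) subL fz by (simp add: G.m_assoc)
    ultimately show "y \<in> cohomology_class L m (f z)"
      using subgroup.m_closed[OF L.coboundaries_subgroup b(1)]
      by (auto simp: cohomology_class_def r_coset_def)
  next
    fix y assume "y \<in> cohomology_class L m (f z)"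
    then obtain b' where b': "b' \<in> coboundaries L m" "y = b' \<otimes>\<^bsub>grp L m\<^esub> f z"
      by (auto simp: cohomology_class_def r_coset_def)
    have "f z = f (\<one>\<^bsub>grp K n\<^esub> \<otimes>\<^bsub>grp K n\<^esub> z)"
      using fb[OF one] f1 fz by simp
    with b' one show "y \<in> cohomology_map L m f (cohomology_class K n z)"
      by (fastforce simp: cohomology_map_def cohomology_class_def set_mult_def r_coset_def)
  qed
qed

text \<open>
  Surjectivity asks for one cocycle that maps to a given family of cocycles exactly, not up to
  coboundaries. It then suffices to choose representatives of a family of classes index by index.
\<close>

lemma cohomology_product_iso:
  assumes L: "\<And>x. x \<in> I \<Longrightarrow> group_sequence (L x)"
    and f: "\<And>x. x \<in> I \<Longrightarrow> f x \<in> hom (grp K n) (grp (L x) m)"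
    and Z: "\<And>x z. x \<in> I \<Longrightarrow> z \<in> cocycles K n \<Longrightarrow> f x z \<in> cocycles (L x) m"
    and B: "\<And>x. x \<in> I \<Longrightarrow> f x ` coboundaries K n \<subseteq> coboundaries (L x) m"
    and inj: "\<And>z. z \<in> cocycles K n \<Longrightarrow> (\<And>x. x \<in> I \<Longrightarrow> f x z \<in> coboundaries (L x) m)
               \<Longrightarrow> z \<in> coboundaries K n"
    and surj: "\<And>t. (\<And>x. x \<in> I \<Longrightarrow> t x \<in> cocycles (L x) m)
               \<Longrightarrow> \<exists>z\<in>cocycles K n. \<forall>x\<in>I. f x z = t x"
  shows "(\<lambda>c. \<lambda>x\<in>I. cohomology_map (L x) m (f x) c)
           \<in> iso (cohomology K n) (product_group I (\<lambda>x. cohomology (L x) m))"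
proof -
  interpret G: comm_group "grp K n" by (rule comm_group_grp)
  have cls: "cohomology_map (L x) m (f x) (cohomology_class K n z) = cohomology_class (L x) m (f x z)"
    if "x \<in> I" "z \<in> cocycles K n" for x z
    using cohomology_map_class[OF L f B] that cocycles_carrier by blast
  have zw: "z \<otimes>\<^bsub>grp K n\<^esub> w \<in> cocycles K n" if "z \<in> cocycles K n" "w \<in> cocycles K n" for z w
    using subgroup.m_closed[OF cocycles_subgroup] that by blast
  have hom: "(\<lambda>c. \<lambda>x\<in>I. cohomology_map (L x) m (f x) c)
           \<in> hom (cohomology K n) (product_group I (\<lambda>x. cohomology (L x) m))"
  proof (rule homI)
    fix c assume "c \<in> carrier (cohomology K n)"
    then show "(\<lambda>x\<in>I. cohomology_map (L x) m (f x) c)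
               \<in> carrier (product_group I (\<lambda>x. cohomology (L x) m))"
      using Z by (auto simp: carrier_cohomology group_sequence.carrier_cohomology[OF L] cls)
  next
    fix c d assume "c \<in> carrier (cohomology K n)" "d \<in> carrier (cohomology K n)"
    then obtain z w where zw': "z \<in> cocycles K n" "w \<in> cocycles K n"
      and cd: "c = cohomology_class K n z" "d = cohomology_class K n w"
      by (auto simp: carrier_cohomology)
    have "f x (z \<otimes>\<^bsub>grp K n\<^esub> w) = f x z \<otimes>\<^bsub>grp (L x) m\<^esub> f x w" if "x \<in> I" for x
      using hom_mult[OF f[OF that]] zw' cocycles_carrier by blast
    then show "(\<lambda>x\<in>I. cohomology_map (L x) m (f x) (c \<otimes>\<^bsub>cohomology K n\<^esub> d)) =
        (\<lambda>x\<in>I. cohomology_map (L x) m (f x) c)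
          \<otimes>\<^bsub>product_group I (\<lambda>x. cohomology (L x) m)\<^esub>
        (\<lambda>x\<in>I. cohomology_map (L x) m (f x) d)"
      using zw' Z by (auto simp: cd mult_cohomology cls zw fun_eq_iff
          group_sequence.mult_cohomology[OF L])
  qed
  have "inj_on (\<lambda>c. \<lambda>x\<in>I. cohomology_map (L x) m (f x) c) (carrier (cohomology K n))"
  proof (rule inj_onI)
    fix c d assume "c \<in> carrier (cohomology K n)" "d \<in> carrier (cohomology K n)"
      and eq: "(\<lambda>x\<in>I. cohomology_map (L x) m (f x) c) = (\<lambda>x\<in>I. cohomology_map (L x) m (f x) d)"
    then obtain z w where zw': "z \<in> cocycles K n" "w \<in> cocycles K n"
      and cd: "c = cohomology_class K n z" "d = cohomology_class K n w"
      by (auto simp: carrier_cohomology)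
    let ?v = "z \<otimes>\<^bsub>grp K n\<^esub> inv\<^bsub>grp K n\<^esub> w"
    have v: "?v \<in> cocycles K n"
      by (rule zw[OF zw'(1) subgroup.m_inv_closed[OF cocycles_subgroup zw'(2)]])
    have "f x ?v \<in> coboundaries (L x) m" if x: "x \<in> I" for x
    proof -
      interpret L: group_sequence "L x" by (rule L[OF x])
      interpret h: group_hom "grp K n" "grp (L x) m" "f x"
        using f[OF x] L.comm_group_grp[of m]
        by (simp add: group_hom_def group_hom_axioms_def comm_group.axioms(2) G.is_group)
      have "cohomology_class (L x) m (f x z) = cohomology_class (L x) m (f x w)"
        using fun_cong[OF eq, of x] x zw' by (simp add: cd cls)
      then have "f x z \<otimes>\<^bsub>grp (L x) m\<^esub> inv\<^bsub>grp (L x) m\<^esub> f x w \<in> coboundaries (L x) m"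
        using L.cohomology_class_eq_iff zw'[THEN cocycles_carrier] h.hom_closed by blast
      then show ?thesis using zw'[THEN cocycles_carrier] by simp
    qed
    then have "?v \<in> coboundaries K n" by (rule inj[OF v])
    then show "c = d" using zw'[THEN cocycles_carrier] by (simp add: cd cohomology_class_eq_iff)
  qed
  moreover have "carrier (product_group I (\<lambda>x. cohomology (L x) m))
      \<subseteq> (\<lambda>c. \<lambda>x\<in>I. cohomology_map (L x) m (f x) c) ` carrier (cohomology K n)"
  proof
    fix e assume e: "e \<in> carrier (product_group I (\<lambda>x. cohomology (L x) m))"
    then have "\<forall>x\<in>I. \<exists>t\<in>cocycles (L x) m. e x = cohomology_class (L x) m t"
      by (auto simp: group_sequence.carrier_cohomology[OF L] PiE_iff image_iff)
    then obtain t where t: "\<And>x. x \<in> I \<Longrightarrow> t x \<in> cocycles (L x) m"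
      "\<And>x. x \<in> I \<Longrightarrow> e x = cohomology_class (L x) m (t x)"
      by metis
    obtain z where z: "z \<in> cocycles K n" "\<forall>x\<in>I. f x z = t x" using surj[OF t(1)] by blast
    have "e = (\<lambda>x\<in>I. cohomology_map (L x) m (f x) (cohomology_class K n z))"
      using e z t(2) by (auto simp: PiE_iff extensional_def cls fun_eq_iff)
    then show "e \<in> (\<lambda>c. \<lambda>x\<in>I. cohomology_map (L x) m (f x) c) ` carrier (cohomology K n)"
      using z by (auto simp: carrier_cohomology)
  qed
  ultimately show ?thesis
    using hom by (auto simp: iso_def bij_betw_def hom_def)
qed

end

section \<open>Alternating products\<close>

text \<open>
  The alternating sum \<open>f 0 - f 1 + f 2 - \<dots>\<close> of \<open>k\<close> terms in multiplicative notation, with the last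
  term split off, because appending a vertex to a simplex adds one face at the end.
\<close>

primrec alternating_prod :: "('b, 'm) monoid_scheme \<Rightarrow> nat \<Rightarrow> (nat \<Rightarrow> 'b) \<Rightarrow> 'b" where
  "alternating_prod G 0 f = \<one>\<^bsub>G\<^esub>"
| "alternating_prod G (Suc k) f = alternating_prod G k f \<otimes>\<^bsub>G\<^esub> f k [^]\<^bsub>G\<^esub> ((-1) ^ k :: int)"

lemma alternating_prod_cong:
  "(\<And>i. i < k \<Longrightarrow> f i = g i) \<Longrightarrow> alternating_prod G k f = alternating_prod G k g"
  by (induction k) auto

context comm_group
begin

lemma alternating_prod_closed:
  "(\<And>i. i < k \<Longrightarrow> f i \<in> carrier G) \<Longrightarrow> alternating_prod G k f \<in> carrier G"
  by (induction k) auto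

lemma alternating_prod_eq_finprod:
  "(\<And>i. i < k \<Longrightarrow> f i \<in> carrier G)
    \<Longrightarrow> alternating_prod G k f = (\<Otimes>i\<in>{..<k}. f i [^] ((-1) ^ i :: int))"
proof (induction k)
  case (Suc k)
  then have "(\<Otimes>i\<in>{..<Suc k}. f i [^] ((-1) ^ i :: int))
      = f k [^] ((-1) ^ k :: int) \<otimes> (\<Otimes>i\<in>{..<k}. f i [^] ((-1) ^ i :: int))"
    unfolding lessThan_Suc by (intro finprod_insert) auto
  with Suc show ?case by (simp add: m_comm alternating_prod_closed)
qed simp

lemma alternating_prod_mult:
  assumes "\<And>i. i < k \<Longrightarrow> f i \<in> carrier G" "\<And>i. i < k \<Longrightarrow> g i \<in> carrier G"
  shows "alternating_prod G k (\<lambda>i. f i \<otimes> g i) = alternating_prod G k f \<otimes> alternating_prod G k g"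
  using assms
  by (induction k) (auto simp: int_pow_distrib alternating_prod_closed m_ac)

lemma alternating_prod_one:
  assumes "\<And>i. i < k \<Longrightarrow> f i = \<one>"
  shows "alternating_prod G k f = \<one>"
  using assms by (induction k) auto

text \<open>
  This is the cancellation of the two equal faces of a degenerate simplex whose last two vertices
  agree.
\<close>

lemma alternating_prod_cancel:
  assumes "\<And>i. i < k \<Longrightarrow> f i = \<one>" "f (Suc k) = f k" "f k \<in> carrier G"
  shows "alternating_prod G (Suc (Suc k)) f = \<one>"
proof -
  have "f k [^] ((-1) ^ k :: int) \<otimes> f k [^] (- ((-1) ^ k) :: int) = \<one>"
    using assms(3) by (simp add: int_pow_neg)
  with assms show ?thesis by (simp add: alternating_prod_one)
qed

end

lemma hom_alternating_prod:
  assumes "comm_group G" "comm_group H" "h \<in> hom G H"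
    and "\<And>i. i < k \<Longrightarrow> f i \<in> carrier G"
  shows "h (alternating_prod G k f) = alternating_prod H k (\<lambda>i. h (f i))"
proof -
  interpret G: comm_group G by fact
  interpret H: comm_group H by fact
  interpret h: group_hom G H h by unfold_locales fact
  show ?thesis
    using assms(4) by (induction k) (auto simp: G.alternating_prod_closed h.hom_int_pow)
qed

section \<open>Simplices and faces\<close>

text \<open>
  The empty list satisfies the defining conditions of a simplex of degree \<open>-1\<close>, so the augmented
  nerve has a description without case distinction; arguments about links are uniform in the degree
  when they start from it.
\<close>

lemma aug_nerve_iff:
  "\<sigma> \<in> aug_nerve P n \<longleftrightarrow> int (length \<sigma>) = n + 1 \<and> set \<sigma> \<subseteq> P \<and> sorted_wrt (\<ge>) \<sigma>"
  by (auto simp: aug_nerve_def nerve_def)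

lemma nerve_iff: "\<sigma> \<in> nerve P n \<longleftrightarrow> \<sigma> \<in> aug_nerve P n \<and> \<sigma> \<noteq> []"
  by (auto simp: aug_nerve_iff nerve_def)

lemma aug_nerve_eq_nerve: "n \<noteq> -1 \<Longrightarrow> aug_nerve P n = nerve P n"
  by (simp add: aug_nerve_def)

lemma nerve_mono: "Q \<subseteq> P \<Longrightarrow> nerve Q n \<subseteq> nerve P n"
  by (auto simp: nerve_def)

lemma last_in_poset: "\<sigma> \<in> nerve P n \<Longrightarrow> last \<sigma> \<in> P"
  by (auto simp: nerve_def)

lemma last_le:
  assumes "\<sigma> \<in> nerve P n" "y \<in> set \<sigma>"
  shows "last \<sigma> \<le> y"
proof -
  have \<sigma>: "\<sigma> = butlast \<sigma> @ [last \<sigma>]" "sorted_wrt (\<ge>) \<sigma>" using assms by (auto simp: nerve_def)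
  have "sorted_wrt (\<ge>) (butlast \<sigma> @ [last \<sigma>])" using \<sigma> by simp
  then have "\<forall>y\<in>set (butlast \<sigma>). last \<sigma> \<le> y" by (auto simp: sorted_wrt_append)
  moreover have "y \<in> set (butlast \<sigma> @ [last \<sigma>])" using assms(2) \<sigma>(1) by simp
  ultimately show ?thesis by auto
qed

lemma face_snoc: "i < length \<tau> \<Longrightarrow> face i (\<tau> @ [x]) = face i \<tau> @ [x]"
  by (simp add: face_def)

lemma face_length_snoc: "face (length \<tau>) (\<tau> @ [x]) = \<tau>"
  by (simp add: face_def)

lemma face_subset: "set (face i \<sigma>) \<subseteq> set \<sigma>"
  by (auto simp: face_def dest: in_set_takeD in_set_dropD)

lemma face_in_aug_nerve:
  assumes "\<sigma> \<in> aug_nerve P (n + 1)" "i < length \<sigma>"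
  shows "face i \<sigma> \<in> aug_nerve P n"
proof -
  have "sorted_wrt (\<ge>) (take i \<sigma> @ \<sigma> ! i # drop (Suc i) \<sigma>)"
    using assms id_take_nth_drop[of i \<sigma>] by (simp add: aug_nerve_iff)
  then have "sorted_wrt (\<ge>) (face i \<sigma>)" by (simp add: face_def sorted_wrt_append)
  moreover have "int (length (face i \<sigma>)) = n + 1" using assms by (auto simp: face_def aug_nerve_iff)
  ultimately show ?thesis using assms face_subset[of i \<sigma>] by (auto simp: aug_nerve_iff)
qed

lemma face_in_nerve:
  assumes "\<sigma> \<in> nerve P (n + 1)" "i < length \<sigma>" "0 \<le> n"
  shows "face i \<sigma> \<in> nerve P n"
proof -
  have "face i \<sigma> \<in> aug_nerve P n" using assms by (intro face_in_aug_nerve) (simp_all add: nerve_iff)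
  then show ?thesis using assms(3) by (simp add: aug_nerve_eq_nerve)
qed

lemma last_face:
  assumes "Suc i < length \<sigma>"
  shows "last (face i \<sigma>) = last \<sigma>"
proof -
  have "\<sigma> \<noteq> []" using assms by auto
  then have "\<sigma> = butlast \<sigma> @ [last \<sigma>]" by simp
  moreover have "face i (butlast \<sigma> @ [last \<sigma>]) = face i (butlast \<sigma>) @ [last \<sigma>]"
    using assms by (intro face_snoc) auto
  ultimately show ?thesis by (metis last_snoc)
qed

lemma last_le_last_face:
  assumes "\<sigma> \<in> nerve P (n + 1)" "i < length \<sigma>" "0 \<le> n"
  shows "last \<sigma> \<le> last (face i \<sigma>)"
proof (rule last_le[OF assms(1)])
  have "face i \<sigma> \<noteq> []" using face_in_nerve[OF assms] by (simp add: nerve_def)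
  then show "last (face i \<sigma>) \<in> set \<sigma>" using face_subset[of i \<sigma>] last_in_set by blast
qed

section \<open>The differentials as alternating products\<close>

lemma presheaf_comm_group: "presheaf_on P F \<Longrightarrow> x \<in> P \<Longrightarrow> comm_group (obj F x)"
  by (simp add: presheaf_on_def)

lemma presheaf_res_hom:
  "presheaf_on P F \<Longrightarrow> x \<in> P \<Longrightarrow> y \<in> P \<Longrightarrow> x \<le> y \<Longrightarrow> res F x y \<in> hom (obj F y) (obj F x)"
  by (simp add: presheaf_on_def)

lemma presheaf_res_refl:
  "presheaf_on P F \<Longrightarrow> x \<in> P \<Longrightarrow> a \<in> carrier (obj F x) \<Longrightarrow> res F x x a = a"
  by (simp add: presheaf_on_def)

lemma presheaf_on_subset: "presheaf_on P F \<Longrightarrow> Q \<subseteq> P \<Longrightarrow> presheaf_on Q F"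
  by (simp add: presheaf_on_def subset_iff)

lemma presheaf_hom_subset: "presheaf_hom P F G \<phi> \<Longrightarrow> Q \<subseteq> P \<Longrightarrow> presheaf_hom Q F G \<phi>"
  by (simp add: presheaf_hom_def subset_iff)

lemma const_presheaf_on: "comm_group A \<Longrightarrow> presheaf_on P (const_presheaf A)"
  by (auto simp: presheaf_on_def const_presheaf_def hom_def)

lemma cochains_carrier_iff:
  "s \<in> carrier (cochains P F n) \<longleftrightarrow>
     s \<in> extensional (nerve P n) \<and> (\<forall>\<sigma>\<in>nerve P n. s \<sigma> \<in> carrier (obj F (last \<sigma>)))"
  by (auto simp: cochains_def PiE_iff)

lemma red_cochains_carrier_iff:
  "t \<in> carrier (red_cochains P A n) \<longleftrightarrow>
     t \<in> extensional (aug_nerve P n) \<and> (\<forall>\<tau>\<in>aug_nerve P n. t \<tau> \<in> carrier A)"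
  by (auto simp: red_cochains_def PiE_iff)

text \<open>
  The \<open>i\<close>-th term of the differential before the sign, brought into the value of \<open>F\<close> at the last
  vertex of the simplex. Transport along the restriction map is the identity for all faces but the
  last one, and including it for all of them makes the formula for the differential uniform.
\<close>

definition transported_face :: "('a, 'b) presheaf \<Rightarrow> ('a list \<Rightarrow> 'b) \<Rightarrow> 'a list \<Rightarrow> nat \<Rightarrow> 'b" where
  "transported_face F s \<sigma> i = res F (last \<sigma>) (last (face i \<sigma>)) (s (face i \<sigma>))"

lemma res_face_hom:
  assumes F: "presheaf_on P F" and \<sigma>: "\<sigma> \<in> nerve P (n + 1)" "i < length \<sigma>" "0 \<le> n"
  shows "res F (last \<sigma>) (last (face i \<sigma>)) \<in> hom (obj F (last (face i \<sigma>))) (obj F (last \<sigma>))"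
  by (rule presheaf_res_hom[OF F last_in_poset[OF \<sigma>(1)] last_in_poset[OF face_in_nerve[OF \<sigma>]]
        last_le_last_face[OF \<sigma>]])

lemma transported_face_closed:
  assumes F: "presheaf_on P F" and s: "s \<in> carrier (cochains P F n)"
    and \<sigma>: "\<sigma> \<in> nerve P (n + 1)" "i < length \<sigma>" "0 \<le> n"
  shows "transported_face F s \<sigma> i \<in> carrier (obj F (last \<sigma>))"
  using s face_in_nerve[OF \<sigma>] hom_in_carrier[OF res_face_hom[OF F \<sigma>]]
  by (auto simp: transported_face_def cochains_carrier_iff)

lemma transported_face_one:
  assumes F: "presheaf_on P F" and \<sigma>: "\<sigma> \<in> nerve P (n + 1)" "i < length \<sigma>" "0 \<le> n"
    and one: "s (face i \<sigma>) = \<one>\<^bsub>obj F (last (face i \<sigma>))\<^esub>"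
  shows "transported_face F s \<sigma> i = \<one>\<^bsub>obj F (last \<sigma>)\<^esub>"
  unfolding transported_face_def one
  using presheaf_comm_group[OF F] last_in_poset[OF \<sigma>(1)] last_in_poset[OF face_in_nerve[OF \<sigma>]]
  by (intro hom_one[OF res_face_hom[OF F \<sigma>]]) (auto simp: comm_group.axioms(2))

lemma transported_face_same_last:
  assumes F: "presheaf_on P F" and s: "s \<in> carrier (cochains P F n)"
    and \<sigma>: "\<sigma> \<in> nerve P (n + 1)" "i < length \<sigma>" "0 \<le> n" and "last (face i \<sigma>) = last \<sigma>"
  shows "transported_face F s \<sigma> i = s (face i \<sigma>)"
proof -
  have "s (face i \<sigma>) \<in> carrier (obj F (last (face i \<sigma>)))"
    using s face_in_nerve[OF \<sigma>] by (simp add: cochains_carrier_iff)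
  then show ?thesis
    unfolding transported_face_def assms(6)
    by (rule presheaf_res_refl[OF F last_in_poset[OF \<sigma>(1)]])
qed

lemma differential_eq_alternating_prod:
  assumes F: "presheaf_on P F" and s: "s \<in> carrier (cochains P F n)"
    and \<sigma>: "\<sigma> \<in> nerve P (n + 1)" and n: "0 \<le> n"
  shows "differential P F n s \<sigma>
    = alternating_prod (obj F (last \<sigma>)) (length \<sigma>) (transported_face F s \<sigma>)"
proof -
  define m where "m = nat (n + 1)"
  have len: "length \<sigma> = Suc m" using \<sigma> n unfolding m_def nerve_def by simp linarith
  then have ne: "\<sigma> \<noteq> []" by auto
  have m: "0 < m" using n by (simp add: m_def)
  have lst: "\<sigma> ! m = last \<sigma>" using len by (simp add: last_conv_nth[OF ne])
  have "face m \<sigma> = butlast \<sigma>" using len by (simp add: face_def butlast_conv_take)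
  then have lst': "\<sigma> ! (m - Suc 0) = last (face m \<sigma>)"
  proof -
    have "butlast \<sigma> \<noteq> []" using len m by (auto simp flip: length_0_conv)
    then show ?thesis
      using len m by (simp add: \<open>face m \<sigma> = butlast \<sigma>\<close> last_conv_nth nth_butlast)
  qed
  interpret A: comm_group "obj F (last \<sigma>)"
    by (rule presheaf_comm_group[OF F last_in_poset[OF \<sigma>]])
  have cl: "\<And>i. i < Suc m \<Longrightarrow> transported_face F s \<sigma> i \<in> carrier (obj F (last \<sigma>))"
    using transported_face_closed[OF F s \<sigma> _ n] len by simp
  have eq: "transported_face F s \<sigma> i = s (face i \<sigma>)" if "i < m" for i
    by (rule transported_face_same_last[OF F s \<sigma> _ n last_face]) (use that len in auto)
  have "(\<Otimes>\<^bsub>obj F (last \<sigma>)\<^esub>i\<in>{..<m}. s (face i \<sigma>) [^]\<^bsub>obj F (last \<sigma>)\<^esub> ((-1) ^ i :: int))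
      = alternating_prod (obj F (last \<sigma>)) m (transported_face F s \<sigma>)"
    using cl eq by (subst A.alternating_prod_eq_finprod) (auto intro!: A.finprod_cong' simp flip: eq)
  then show ?thesis
    using \<sigma> n by (simp add: differential_def Let_def lst lst' len transported_face_def
        flip: m_def)
qed

lemma differential_negative: "n < 0 \<Longrightarrow> differential P F n s = \<one>\<^bsub>cochains P F (n + 1)\<^esub>"
  by (simp add: differential_def)

lemma differential_extensional: "differential P F n s \<in> extensional (nerve P (n + 1))"
  by (simp add: differential_def cochains_def)

lemma differential_closed:
  assumes F: "presheaf_on P F" and s: "s \<in> carrier (cochains P F n)" and n: "0 \<le> n"
    and \<sigma>: "\<sigma> \<in> nerve P (n + 1)"
  shows "differential P F n s \<sigma> \<in> carrier (obj F (last \<sigma>))"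
proof -
  interpret A: comm_group "obj F (last \<sigma>)"
    by (rule presheaf_comm_group[OF F last_in_poset[OF \<sigma>]])
  show ?thesis
    using A.alternating_prod_closed transported_face_closed[OF F s \<sigma> _ n]
    by (simp add: differential_eq_alternating_prod[OF F s \<sigma> n])
qed

lemma red_cochains_eq_cochains:
  "n \<noteq> -1 \<Longrightarrow> red_cochains P A n = cochains P (const_presheaf A) n"
  by (simp add: red_cochains_def cochains_def aug_nerve_eq_nerve const_presheaf_def)

text \<open>
  In degree \<open>-1\<close> the only face of a vertex is the empty simplex, so the diagonal map is given by
  the same formula as the other differentials.
\<close>

lemma red_differential_eq_alternating_prod:
  assumes A: "comm_group A" and t: "t \<in> carrier (red_cochains P A n)"
    and \<tau>: "\<tau> \<in> aug_nerve P (n + 1)" and n: "-1 \<le> n"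
  shows "red_differential P A n t \<tau> = alternating_prod A (length \<tau>) (\<lambda>i. t (face i \<tau>))"
proof (cases "n = -1")
  case True
  then obtain v where "\<tau> = [v]" using \<tau> by (auto simp: aug_nerve_iff length_Suc_conv)
  interpret comm_group A by fact
  have "t [] \<in> carrier A" using t True by (auto simp: red_cochains_carrier_iff aug_nerve_iff)
  then show ?thesis
    using True \<tau> by (simp add: red_differential_def \<open>\<tau> = [v]\<close> face_def aug_nerve_def)
next
  case False
  then show ?thesis
    using differential_eq_alternating_prod[OF const_presheaf_on[OF A], of t P n \<tau>] t \<tau> n
    by (simp add: red_differential_def red_cochains_eq_cochains aug_nerve_eq_nerve
        transported_face_def[abs_def] const_presheaf_def)
qed

lemma red_differential_low: "n < -1 \<Longrightarrow> red_differential P A n t = \<one>\<^bsub>red_cochains P A (n + 1)\<^esub>"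
  by (simp add: red_differential_def)

lemma red_differential_extensional:
  "red_differential P A n t \<in> extensional (aug_nerve P (n + 1))"
  using differential_extensional[of P "const_presheaf A" n t]
  by (auto simp: red_differential_def red_cochains_def aug_nerve_eq_nerve)

section \<open>The relative and the reduced complex\<close>

lemma rel_carrier_iff:
  "s \<in> carrier (grp (rel_cochain_cx P Q F) n) \<longleftrightarrow>
     s \<in> carrier (cochains P F n) \<and> (\<forall>\<sigma>\<in>nerve Q n. s \<sigma> = \<one>\<^bsub>obj F (last \<sigma>)\<^esub>)"
  unfolding rel_cochain_cx_def kernel_def by (auto simp: cochains_def fun_eq_iff restrict_def)

lemma rel_mult: "s \<otimes>\<^bsub>grp (rel_cochain_cx P Q F) n\<^esub> t
     = (\<lambda>\<sigma>\<in>nerve P n. s \<sigma> \<otimes>\<^bsub>obj F (last \<sigma>)\<^esub> t \<sigma>)"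
  by (simp add: rel_cochain_cx_def cochains_def)

lemma rel_one: "\<one>\<^bsub>grp (rel_cochain_cx P Q F) n\<^esub> = (\<lambda>\<sigma>\<in>nerve P n. \<one>\<^bsub>obj F (last \<sigma>)\<^esub>)"
  by (simp add: rel_cochain_cx_def cochains_def)

lemma rel_dif: "dif (rel_cochain_cx P Q F) = differential P F"
  by (simp add: rel_cochain_cx_def)

lemma red_carrier: "grp (red_cochain_cx P A) = red_cochains P A"
  by (simp add: red_cochain_cx_def)

lemma red_mult: "s \<otimes>\<^bsub>red_cochains P A n\<^esub> t = (\<lambda>\<sigma>\<in>aug_nerve P n. s \<sigma> \<otimes>\<^bsub>A\<^esub> t \<sigma>)"
  by (simp add: red_cochains_def)

lemma red_one: "\<one>\<^bsub>red_cochains P A n\<^esub> = (\<lambda>\<sigma>\<in>aug_nerve P n. \<one>\<^bsub>A\<^esub>)"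
  by (simp add: red_cochains_def)

lemma red_dif: "dif (red_cochain_cx P A) = red_differential P A"
  by (simp add: red_cochain_cx_def)

lemma comm_group_product_group:
  assumes "\<And>i. i \<in> I \<Longrightarrow> comm_group (G i)"
  shows "comm_group (product_group I G)"
proof -
  interpret group "product_group I G"
    using assms by (intro product_group) (simp add: comm_group.axioms(2))
  show ?thesis
    by (rule group_comm_groupI)
      (use assms in \<open>auto simp: PiE_iff comm_group_def comm_monoid.m_comm fun_eq_iff restrict_def\<close>)
qed

lemma comm_group_cochains: "presheaf_on P F \<Longrightarrow> comm_group (cochains P F n)"
  unfolding cochains_def
  by (intro comm_group_product_group) (blast intro: presheaf_comm_group last_in_poset)

lemma rel_cochains_comm_group:
  assumes F: "presheaf_on P F" and Q: "Q \<subseteq> P"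
  shows "comm_group (grp (rel_cochain_cx P Q F) n)"
proof -
  interpret P: comm_group "cochains P F n" by (rule comm_group_cochains[OF F])
  interpret Q: comm_group "cochains Q F n"
    by (rule comm_group_cochains[OF presheaf_on_subset[OF F Q]])
  have "(\<lambda>s. restrict s (nerve Q n)) \<in> hom (cochains P F n) (cochains Q F n)"
  proof (rule homI)
    fix s assume "s \<in> carrier (cochains P F n)"
    then show "restrict s (nerve Q n) \<in> carrier (cochains Q F n)"
      using nerve_mono[OF Q] by (auto simp: cochains_carrier_iff)
  next
    fix s t
    show "restrict (s \<otimes>\<^bsub>cochains P F n\<^esub> t) (nerve Q n)
        = restrict s (nerve Q n) \<otimes>\<^bsub>cochains Q F n\<^esub> restrict t (nerve Q n)"
      using nerve_mono[OF Q] by (auto simp: cochains_def fun_eq_iff)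
  qed
  then interpret group_hom "cochains P F n" "cochains Q F n" "\<lambda>s. restrict s (nerve Q n)"
    by unfold_locales
  show ?thesis
    using comm_group_subgroup[OF P.comm_group_axioms subgroup_kernel]
    by (simp add: rel_cochain_cx_def)
qed

text \<open>
  The faces of a simplex of \<open>Q\<close> lie in \<open>Q\<close>, so the differential preserves cochains that vanish
  on \<open>Q\<close>.
\<close>

lemma rel_group_sequence:
  assumes F: "presheaf_on P F" and Q: "Q \<subseteq> P"
  shows "group_sequence (rel_cochain_cx P Q F)"
proof (rule group_sequence.intro)
  fix n
  show "comm_group (grp (rel_cochain_cx P Q F) n)"
    by (rule rel_cochains_comm_group[OF F Q])
  show "dif (rel_cochain_cx P Q F) n
      \<in> hom (grp (rel_cochain_cx P Q F) n) (grp (rel_cochain_cx P Q F) (n + 1))"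
  proof (cases "n < 0")
    case True
    interpret G: comm_group "grp (rel_cochain_cx P Q F) (n + 1)"
      by (rule rel_cochains_comm_group[OF F Q])
    have "dif (rel_cochain_cx P Q F) n = (\<lambda>_. \<one>\<^bsub>grp (rel_cochain_cx P Q F) (n + 1)\<^esub>)"
      using True by (simp add: rel_dif fun_eq_iff differential_negative rel_one cochains_def)
    then show ?thesis by (simp add: hom_def)
  next
    case False
    then have n: "0 \<le> n" by simp
    show ?thesis
    proof (rule homI)
      fix s assume "s \<in> carrier (grp (rel_cochain_cx P Q F) n)"
      then have s: "s \<in> carrier (cochains P F n)"
        and sQ: "\<And>\<sigma>. \<sigma> \<in> nerve Q n \<Longrightarrow> s \<sigma> = \<one>\<^bsub>obj F (last \<sigma>)\<^esub>" by (auto simp: rel_carrier_iff)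
      have "differential P F n s \<sigma> = \<one>\<^bsub>obj F (last \<sigma>)\<^esub>" if \<sigma>: "\<sigma> \<in> nerve Q (n + 1)" for \<sigma>
      proof -
        have \<sigma>P: "\<sigma> \<in> nerve P (n + 1)" using \<sigma> nerve_mono[OF Q] by blast
        interpret A: comm_group "obj F (last \<sigma>)"
          by (rule presheaf_comm_group[OF F last_in_poset[OF \<sigma>P]])
        have "transported_face F s \<sigma> i = \<one>\<^bsub>obj F (last \<sigma>)\<^esub>" if i: "i < length \<sigma>" for i
          by (rule transported_face_one[OF F \<sigma>P i n]) (rule sQ[OF face_in_nerve[OF \<sigma> i n]])
        then show ?thesis
          by (simp add: differential_eq_alternating_prod[OF F s \<sigma>P n] A.alternating_prod_one)
      qed
      then show "dif (rel_cochain_cx P Q F) n s \<in> carrier (grp (rel_cochain_cx P Q F) (n + 1))"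
        using differential_closed[OF F s n] differential_extensional
        by (auto simp: rel_carrier_iff rel_dif cochains_carrier_iff)
    next
      fix s t assume st: "s \<in> carrier (grp (rel_cochain_cx P Q F) n)"
        "t \<in> carrier (grp (rel_cochain_cx P Q F) n)"
      then have s: "s \<in> carrier (cochains P F n)" and t: "t \<in> carrier (cochains P F n)"
        by (auto simp: rel_carrier_iff)
      let ?st = "\<lambda>\<sigma>\<in>nerve P n. s \<sigma> \<otimes>\<^bsub>obj F (last \<sigma>)\<^esub> t \<sigma>"
      interpret G: comm_group "cochains P F n" by (rule comm_group_cochains[OF F])
      have stc: "?st \<in> carrier (cochains P F n)"
        using G.m_closed[OF s t] by (simp add: cochains_def)
      have "differential P F n ?st \<sigma>
          = differential P F n s \<sigma> \<otimes>\<^bsub>obj F (last \<sigma>)\<^esub> differential P F n t \<sigma>"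
        if \<sigma>: "\<sigma> \<in> nerve P (n + 1)" for \<sigma>
      proof -
        interpret A: comm_group "obj F (last \<sigma>)"
          by (rule presheaf_comm_group[OF F last_in_poset[OF \<sigma>]])
        have "transported_face F ?st \<sigma> i
            = transported_face F s \<sigma> i \<otimes>\<^bsub>obj F (last \<sigma>)\<^esub> transported_face F t \<sigma> i"
          if i: "i < length \<sigma>" for i
          using s t face_in_nerve[OF \<sigma> i n] hom_mult[OF res_face_hom[OF F \<sigma> i n]]
          by (simp add: transported_face_def cochains_carrier_iff)
        then have "alternating_prod (obj F (last \<sigma>)) (length \<sigma>) (transported_face F ?st \<sigma>)
            = alternating_prod (obj F (last \<sigma>)) (length \<sigma>)
              (\<lambda>i. transported_face F s \<sigma> i \<otimes>\<^bsub>obj F (last \<sigma>)\<^esub> transported_face F t \<sigma> i)"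
          by (intro alternating_prod_cong)
        also have "\<dots> = alternating_prod (obj F (last \<sigma>)) (length \<sigma>) (transported_face F s \<sigma>)
            \<otimes>\<^bsub>obj F (last \<sigma>)\<^esub> alternating_prod (obj F (last \<sigma>)) (length \<sigma>) (transported_face F t \<sigma>)"
          by (intro A.alternating_prod_mult transported_face_closed[OF F _ \<sigma> _ n] s t)
        finally show ?thesis
          by (simp only: differential_eq_alternating_prod[OF F _ \<sigma> n] s t stc)
      qed
      then show "dif (rel_cochain_cx P Q F) n (s \<otimes>\<^bsub>grp (rel_cochain_cx P Q F) n\<^esub> t)
          = dif (rel_cochain_cx P Q F) n s \<otimes>\<^bsub>grp (rel_cochain_cx P Q F) (n + 1)\<^esub>
            dif (rel_cochain_cx P Q F) n t"
        unfolding rel_mult rel_dif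
        using differential_extensional[of P F n ?st] by (auto simp: fun_eq_iff extensional_def)
    qed
  qed
qed

lemma red_group_sequence:
  assumes A: "comm_group A"
  shows "group_sequence (red_cochain_cx P A)"
proof (rule group_sequence.intro)
  interpret A: comm_group A by fact
  fix n
  have cg: "comm_group (red_cochains P A k)" for k
    unfolding red_cochains_def by (intro comm_group_product_group A)
  show "comm_group (grp (red_cochain_cx P A) n)" by (simp add: red_carrier cg)
  show "dif (red_cochain_cx P A) n \<in> hom (grp (red_cochain_cx P A) n) (grp (red_cochain_cx P A) (n + 1))"
    unfolding red_carrier red_dif
  proof (cases "n < -1")
    case True
    interpret G: comm_group "red_cochains P A (n + 1)" by (rule cg)
    have "red_differential P A n = (\<lambda>_. \<one>\<^bsub>red_cochains P A (n + 1)\<^esub>)"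
      using True by (simp add: fun_eq_iff red_differential_low)
    then show "red_differential P A n \<in> hom (red_cochains P A n) (red_cochains P A (n + 1))"
      by (simp add: hom_def)
  next
    case False
    then have n: "-1 \<le> n" by simp
    show "red_differential P A n \<in> hom (red_cochains P A n) (red_cochains P A (n + 1))"
    proof (rule homI)
      fix t assume t: "t \<in> carrier (red_cochains P A n)"
      have "red_differential P A n t \<tau> \<in> carrier A" if "\<tau> \<in> aug_nerve P (n + 1)" for \<tau>
        unfolding red_differential_eq_alternating_prod[OF A t that n]
        using t face_in_aug_nerve[OF that]
        by (intro A.alternating_prod_closed) (auto simp: red_cochains_carrier_iff)
      then show "red_differential P A n t \<in> carrier (red_cochains P A (n + 1))"
        using red_differential_extensional by (auto simp: red_cochains_carrier_iff)
    next
      fix s t assume s: "s \<in> carrier (red_cochains P A n)" and t: "t \<in> carrier (red_cochains P A n)"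
      interpret G: comm_group "red_cochains P A n" by (rule cg)
      have "red_differential P A n (s \<otimes>\<^bsub>red_cochains P A n\<^esub> t) \<tau>
          = red_differential P A n s \<tau> \<otimes>\<^bsub>A\<^esub> red_differential P A n t \<tau>"
        if \<tau>: "\<tau> \<in> aug_nerve P (n + 1)" for \<tau>
      proof -
        note alt = red_differential_eq_alternating_prod[OF A _ \<tau> n]
        have "red_differential P A n (s \<otimes>\<^bsub>red_cochains P A n\<^esub> t) \<tau>
            = alternating_prod A (length \<tau>) (\<lambda>i. s (face i \<tau>) \<otimes>\<^bsub>A\<^esub> t (face i \<tau>))"
          unfolding alt[OF G.m_closed[OF s t]]
          by (intro alternating_prod_cong) (simp add: red_mult face_in_aug_nerve[OF \<tau>])
        also have "\<dots> = red_differential P A n s \<tau> \<otimes>\<^bsub>A\<^esub> red_differential P A n t \<tau>"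
          unfolding alt[OF s] alt[OF t] using s t face_in_aug_nerve[OF \<tau>]
          by (intro A.alternating_prod_mult) (auto simp: red_cochains_carrier_iff)
        finally show ?thesis .
      qed
      then show "red_differential P A n (s \<otimes>\<^bsub>red_cochains P A n\<^esub> t)
          = red_differential P A n s \<otimes>\<^bsub>red_cochains P A (n + 1)\<^esub> red_differential P A n t"
        unfolding red_mult[where n = "n + 1"]
        using red_differential_extensional[of P A n "s \<otimes>\<^bsub>red_cochains P A n\<^esub> t"]
        by (auto simp: fun_eq_iff extensional_def)
    qed
  qed
qed

section \<open>Functoriality in the coefficients\<close>

definition rel_push ::
    "'a::order set \<Rightarrow> int \<Rightarrow> ('a \<Rightarrow> 'b \<Rightarrow> 'b) \<Rightarrow> ('a list \<Rightarrow> 'b) \<Rightarrow> 'a list \<Rightarrow> 'b" where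
  "rel_push P n \<phi> s = (\<lambda>\<sigma>\<in>nerve P n. \<phi> (last \<sigma>) (s \<sigma>))"

definition red_push ::
    "'a::order set \<Rightarrow> int \<Rightarrow> ('b \<Rightarrow> 'b) \<Rightarrow> ('a list \<Rightarrow> 'b) \<Rightarrow> 'a list \<Rightarrow> 'b" where
  "red_push P n h t = (\<lambda>\<tau>\<in>aug_nerve P n. h (t \<tau>))"

context
  fixes P Q :: "'a::order set" and F G :: "('a, 'b) presheaf" and \<phi> :: "'a \<Rightarrow> 'b \<Rightarrow> 'b"
  assumes F: "presheaf_on P F" and G: "presheaf_on P G" and \<phi>: "presheaf_hom P F G \<phi>"
    and Q: "Q \<subseteq> P"
begin

lemma presheaf_hom_at: "x \<in> P \<Longrightarrow> group_hom (obj F x) (obj G x) (\<phi> x)"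
  using \<phi> presheaf_comm_group[OF F] presheaf_comm_group[OF G]
  by (simp add: presheaf_hom_def group_hom_def group_hom_axioms_def comm_group.axioms(2))

lemma rel_push_closed:
  assumes "s \<in> carrier (grp (rel_cochain_cx P Q F) n)"
  shows "rel_push P n \<phi> s \<in> carrier (grp (rel_cochain_cx P Q G) n)"
proof -
  have "\<phi> (last \<sigma>) (s \<sigma>) \<in> carrier (obj G (last \<sigma>))" if "\<sigma> \<in> nerve P n" for \<sigma>
    using assms that group_hom.hom_closed[OF presheaf_hom_at[OF last_in_poset]]
    by (auto simp: rel_carrier_iff cochains_carrier_iff)
  moreover have "\<phi> (last \<sigma>) (s \<sigma>) = \<one>\<^bsub>obj G (last \<sigma>)\<^esub>" if "\<sigma> \<in> nerve Q n" for \<sigma>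
    using assms that nerve_mono[OF Q] group_hom.hom_one[OF presheaf_hom_at[OF last_in_poset]]
    by (auto simp: rel_carrier_iff)
  ultimately show ?thesis
    using nerve_mono[OF Q] by (auto simp: rel_carrier_iff cochains_carrier_iff rel_push_def)
qed

lemma rel_push_hom:
  "rel_push P n \<phi> \<in> hom (grp (rel_cochain_cx P Q F) n) (grp (rel_cochain_cx P Q G) n)"
proof (rule homI)
  fix s t
  assume "s \<in> carrier (grp (rel_cochain_cx P Q F) n)" "t \<in> carrier (grp (rel_cochain_cx P Q F) n)"
  then have "\<phi> (last \<sigma>) (s \<sigma> \<otimes>\<^bsub>obj F (last \<sigma>)\<^esub> t \<sigma>)
      = \<phi> (last \<sigma>) (s \<sigma>) \<otimes>\<^bsub>obj G (last \<sigma>)\<^esub> \<phi> (last \<sigma>) (t \<sigma>)" if "\<sigma> \<in> nerve P n" for \<sigma>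
    using that group_hom.hom_mult[OF presheaf_hom_at[OF last_in_poset[OF that]]]
    by (simp add: rel_carrier_iff cochains_carrier_iff)
  then show "rel_push P n \<phi> (s \<otimes>\<^bsub>grp (rel_cochain_cx P Q F) n\<^esub> t)
      = rel_push P n \<phi> s \<otimes>\<^bsub>grp (rel_cochain_cx P Q G) n\<^esub> rel_push P n \<phi> t"
    by (auto simp: rel_mult rel_push_def fun_eq_iff)
qed (rule rel_push_closed)

text \<open>
  A morphism of presheaves commutes with the transport of the last face; at every simplex it is a
  homomorphism and so commutes with alternating products.
\<close>

lemma rel_push_dif:
  assumes s: "s \<in> carrier (grp (rel_cochain_cx P Q F) n)"
  shows "rel_push P (n + 1) \<phi> (differential P F n s) = differential P G n (rel_push P n \<phi> s)"
proof
  fix \<sigma>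
  show "rel_push P (n + 1) \<phi> (differential P F n s) \<sigma> = differential P G n (rel_push P n \<phi> s) \<sigma>"
  proof (cases "\<sigma> \<in> nerve P (n + 1)")
    case \<sigma>: True
    interpret h: group_hom "obj F (last \<sigma>)" "obj G (last \<sigma>)" "\<phi> (last \<sigma>)"
      by (rule presheaf_hom_at[OF last_in_poset[OF \<sigma>]])
    show ?thesis
    proof (cases "n < 0")
      case True
      then show ?thesis
        using \<sigma> by (simp add: rel_push_def differential_negative cochains_def)
    next
      case False
      then have n: "0 \<le> n" by simp
      have sc: "s \<in> carrier (cochains P F n)" using s by (simp add: rel_carrier_iff)
      have pc: "rel_push P n \<phi> s \<in> carrier (cochains P G n)"
        using rel_push_closed[OF s] by (simp add: rel_carrier_iff)
      have face: "\<phi> (last \<sigma>) (transported_face F s \<sigma> i) = transported_face G (rel_push P n \<phi> s) \<sigma> i"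
        if i: "i < length \<sigma>" for i
      proof -
        have f: "face i \<sigma> \<in> nerve P n" by (rule face_in_nerve[OF \<sigma> i n])
        then have "s (face i \<sigma>) \<in> carrier (obj F (last (face i \<sigma>)))"
          using sc by (simp add: cochains_carrier_iff)
        then show ?thesis
          using \<phi> f last_in_poset[OF \<sigma>] last_in_poset[OF f] last_le_last_face[OF \<sigma> i n]
          by (simp add: transported_face_def rel_push_def presheaf_hom_def)
      qed
      have "\<phi> (last \<sigma>) (differential P F n s \<sigma>) = alternating_prod (obj G (last \<sigma>)) (length \<sigma>)
          (\<lambda>i. \<phi> (last \<sigma>) (transported_face F s \<sigma> i))"
        unfolding differential_eq_alternating_prod[OF F sc \<sigma> n]
        by (rule hom_alternating_prod)
          (use presheaf_comm_group[OF F last_in_poset[OF \<sigma>]]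
            presheaf_comm_group[OF G last_in_poset[OF \<sigma>]] h.homh
            transported_face_closed[OF F sc \<sigma> _ n] in auto)
      also have "\<dots> = differential P G n (rel_push P n \<phi> s) \<sigma>"
        unfolding differential_eq_alternating_prod[OF G pc \<sigma> n]
        by (rule alternating_prod_cong) (rule face)
      finally show ?thesis using \<sigma> by (simp add: rel_push_def)
    qed
  next
    case False
    then show ?thesis
      using differential_extensional[of P G n "rel_push P n \<phi> s"]
      by (simp add: rel_push_def extensional_def)
  qed
qed

lemma rel_cohomology_map_class:
  assumes "s \<in> carrier (grp (rel_cochain_cx P Q F) n)"
  shows "rel_cohomology_map P Q G n \<phi> (cohomology_class (rel_cochain_cx P Q F) n s)
       = cohomology_class (rel_cochain_cx P Q G) n (rel_push P n \<phi> s)"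
proof -
  interpret K: group_sequence "rel_cochain_cx P Q F" by (rule rel_group_sequence[OF F Q])
  have "rel_push P n \<phi> ` coboundaries (rel_cochain_cx P Q F) n
      \<subseteq> coboundaries (rel_cochain_cx P Q G) n"
    using rel_push_dif[of _ "n - 1"]
    by (intro K.coboundaries_image[where g = "rel_push P (n - 1) \<phi>"] rel_push_closed)
      (simp_all add: rel_dif)
  from K.cohomology_map_class[OF rel_group_sequence[OF G Q] rel_push_hom this assms]
  show ?thesis by (simp add: rel_cohomology_map_def rel_push_def[abs_def])
qed

end

context
  fixes P :: "'a::order set" and A B :: "'b monoid" and h :: "'b \<Rightarrow> 'b"
  assumes A: "comm_group A" and B: "comm_group B" and h: "h \<in> hom A B"
begin

interpretation h: group_hom A B h
  using A B h by (simp add: group_hom_def group_hom_axioms_def comm_group.axioms(2))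

lemma red_push_closed:
  "t \<in> carrier (red_cochains P A n) \<Longrightarrow> red_push P n h t \<in> carrier (red_cochains P B n)"
  by (auto simp: red_cochains_carrier_iff red_push_def)

lemma red_push_hom: "red_push P n h \<in> hom (red_cochains P A n) (red_cochains P B n)"
  by (rule homI) (auto intro: red_push_closed
      simp: red_mult red_push_def fun_eq_iff red_cochains_carrier_iff)

lemma red_push_dif:
  assumes t: "t \<in> carrier (red_cochains P A n)"
  shows "red_push P (n + 1) h (red_differential P A n t) = red_differential P B n (red_push P n h t)"
proof
  fix \<tau>
  show "red_push P (n + 1) h (red_differential P A n t) \<tau> = red_differential P B n (red_push P n h t) \<tau>"
  proof (cases "\<tau> \<in> aug_nerve P (n + 1)")
    case \<tau>: True
    show ?thesis
    proof (cases "n < -1")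
      case True
      then show ?thesis using \<tau> by (simp add: red_push_def red_differential_low red_one)
    next
      case False
      then have n: "-1 \<le> n" by simp
      have tc: "t (face i \<tau>) \<in> carrier A" if "i < length \<tau>" for i
        using t face_in_aug_nerve[OF \<tau> that] by (simp add: red_cochains_carrier_iff)
      have "h (red_differential P A n t \<tau>) = alternating_prod B (length \<tau>) (\<lambda>i. h (t (face i \<tau>)))"
        unfolding red_differential_eq_alternating_prod[OF A t \<tau> n]
        by (rule hom_alternating_prod[OF A B h tc])
      also have "\<dots> = red_differential P B n (red_push P n h t) \<tau>"
        unfolding red_differential_eq_alternating_prod[OF B red_push_closed[OF t] \<tau> n]
        by (rule alternating_prod_cong) (simp add: red_push_def face_in_aug_nerve[OF \<tau>])
      finally show ?thesis using \<tau> by (simp add: red_push_def)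
    qed
  next
    case False
    then show ?thesis
      using red_differential_extensional[of P B n "red_push P n h t"]
      by (simp add: red_push_def extensional_def)
  qed
qed

lemma red_cohomology_map_class:
  assumes "t \<in> carrier (red_cochains P A n)"
  shows "red_cohomology_map P B n h (cohomology_class (red_cochain_cx P A) n t)
       = cohomology_class (red_cochain_cx P B) n (red_push P n h t)"
proof -
  interpret K: group_sequence "red_cochain_cx P A" by (rule red_group_sequence[OF A])
  have "red_push P n h ` coboundaries (red_cochain_cx P A) n \<subseteq> coboundaries (red_cochain_cx P B) n"
    using red_push_dif[of _ "n - 1"]
    by (intro K.coboundaries_image[where g = "red_push P (n - 1) h"])
      (simp_all add: red_dif red_carrier red_push_closed)
  from K.cohomology_map_class[OF red_group_sequence[OF B] _ this, unfolded red_carrier,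
      OF red_push_hom assms]
  show ?thesis by (simp add: red_cohomology_map_def red_push_def[abs_def])
qed

end

section \<open>Cohomology relative to the complement of a set of minimal elements\<close>

lemma snoc_in_nerve:
  assumes "x \<in> P" "\<tau> \<in> aug_nerve (strictly_above P x) (n - 1)"
  shows "\<tau> @ [x] \<in> nerve P n"
  using assms by (auto simp: aug_nerve_iff nerve_def strictly_above_def sorted_wrt_append less_imp_le)

lemma butlast_in_link:
  assumes "\<tau> @ [x] \<in> nerve P n" "x \<notin> set \<tau>"
  shows "\<tau> \<in> aug_nerve (strictly_above P x) (n - 1)"
  using assms
  by (auto simp: aug_nerve_iff nerve_def strictly_above_def sorted_wrt_append order.strict_iff_order)

lemma nerve_above:
  assumes "\<sigma> \<in> nerve P n" "x < last \<sigma>"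
  shows "\<sigma> \<in> aug_nerve (strictly_above P x) n"
  using assms last_le[OF assms(1)]
  by (force simp: aug_nerve_iff nerve_def strictly_above_def)

text \<open>
  Evaluation of a cochain on the simplices that end in \<open>x\<close> exactly once. Since \<open>x\<close> is appended at
  the end, the faces of \<open>\<tau>\<close> keep their indices and no sign is needed for a cochain map.
\<close>

definition link_cochain ::
    "'a::order set \<Rightarrow> int \<Rightarrow> 'a \<Rightarrow> ('a list \<Rightarrow> 'b) \<Rightarrow> 'a list \<Rightarrow> 'b" where
  "link_cochain P n x s = (\<lambda>\<tau>\<in>aug_nerve (strictly_above P x) (n - 1). s (\<tau> @ [x]))"

text \<open>
  The section of the maps to links: \<open>t x\<close> is extended by zero from the simplices \<open>\<tau> @ [x]\<close> with all
  vertices of \<open>\<tau>\<close> above \<open>x\<close> to the simplices in which \<open>x\<close> is repeated. The membership test on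
  \<open>butlast \<sigma>\<close> singles out the latter.
\<close>

definition cone_cochain ::
    "'a::order set \<Rightarrow> 'a set \<Rightarrow> ('a, 'b) presheaf \<Rightarrow> int \<Rightarrow> ('a \<Rightarrow> 'a list \<Rightarrow> 'b) \<Rightarrow> 'a list \<Rightarrow> 'b" where
  "cone_cochain P Q F n t = (\<lambda>\<sigma>\<in>nerve P n.
     if last \<sigma> \<in> Q \<or> last \<sigma> \<in> set (butlast \<sigma>) then \<one>\<^bsub>obj F (last \<sigma>)\<^esub>
     else t (last \<sigma>) (butlast \<sigma>))"

definition link_map ::
    "'a::order set \<Rightarrow> 'a set \<Rightarrow> ('a, 'b) presheaf \<Rightarrow> int \<Rightarrow>
     ('a list \<Rightarrow> 'b) set \<Rightarrow> 'a \<Rightarrow> ('a list \<Rightarrow> 'b) set" where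
  "link_map P Q F n c = (\<lambda>x\<in>P - Q.
     cohomology_map (red_cochain_cx (strictly_above P x) (obj F x)) (n - 1) (link_cochain P n x) c)"

text \<open>
  The elements of \<open>P - Q\<close> are minimal in \<open>P\<close>, and moreover \<open>Q\<close> is upward closed. In particular a
  simplex that ends in \<open>x \<in> P - Q\<close> consists of a possibly empty simplex in \<open>Q\<close>
  followed by repetitions of \<open>x\<close>.
\<close>

locale minimal_complement =
  fixes P Q :: "'a::order set" and F :: "('a, 'b) presheaf"
  assumes Q_subset: "Q \<subseteq> P"
    and above_in_Q: "x \<in> P \<Longrightarrow> y \<in> P \<Longrightarrow> x < y \<Longrightarrow> y \<in> Q"
    and presheaf: "presheaf_on P F"
begin

abbreviation "K \<equiv> rel_cochain_cx P Q F"
abbreviation "L x \<equiv> red_cochain_cx (strictly_above P x) (obj F x)"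

sublocale K: group_sequence K
  by (rule rel_group_sequence[OF presheaf Q_subset])

lemma L_group_sequence: "x \<in> P \<Longrightarrow> group_sequence (L x)"
  by (intro red_group_sequence presheaf_comm_group[OF presheaf])

lemma nerve_Q_iff:
  assumes "\<sigma> \<in> nerve P n"
  shows "\<sigma> \<in> nerve Q n \<longleftrightarrow> last \<sigma> \<in> Q"
proof
  assume Q: "last \<sigma> \<in> Q"
  have "y \<in> Q" if "y \<in> set \<sigma>" for y
  proof (cases "y = last \<sigma>")
    case False
    then have "last \<sigma> < y" using last_le[OF assms that] by simp
    moreover have "y \<in> P" using assms that by (auto simp: nerve_def)
    ultimately show ?thesis using above_in_Q last_in_poset[OF assms] by blast
  qed (simp add: Q)
  then show "\<sigma> \<in> nerve Q n" using assms by (auto simp: nerve_def)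
qed (rule last_in_poset)

lemma rel_cochain_one:
  "s \<in> carrier (grp K n) \<Longrightarrow> \<sigma> \<in> nerve P n \<Longrightarrow> last \<sigma> \<in> Q \<Longrightarrow> s \<sigma> = \<one>\<^bsub>obj F (last \<sigma>)\<^esub>"
  using nerve_Q_iff by (auto simp: rel_carrier_iff)

lemma dif_closed: "s \<in> carrier (grp K n) \<Longrightarrow> differential P F n s \<in> carrier (grp K (n + 1))"
  using hom_in_carrier[OF K.dif_hom] by (simp add: rel_dif)

lemma link_cochain_closed:
  assumes "x \<in> P" "s \<in> carrier (grp K n)"
  shows "link_cochain P n x s \<in> carrier (grp (L x) (n - 1))"
proof -
  have "s (\<tau> @ [x]) \<in> carrier (obj F x)"
    if "\<tau> \<in> aug_nerve (strictly_above P x) (n - 1)" for \<tau>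
    using assms snoc_in_nerve[OF assms(1) that]
    by (force simp: rel_carrier_iff cochains_carrier_iff)
  then show ?thesis by (auto simp: red_carrier red_cochains_carrier_iff link_cochain_def)
qed

lemma link_cochain_hom:
  assumes "x \<in> P"
  shows "link_cochain P n x \<in> hom (grp K n) (grp (L x) (n - 1))"
proof (rule homI)
  fix s t
  show "link_cochain P n x (s \<otimes>\<^bsub>grp K n\<^esub> t)
      = link_cochain P n x s \<otimes>\<^bsub>grp (L x) (n - 1)\<^esub> link_cochain P n x t"
    using snoc_in_nerve[OF assms]
    by (auto simp: rel_mult red_mult red_carrier link_cochain_def fun_eq_iff)
qed (rule link_cochain_closed[OF assms])

lemma link_cochain_one:
  assumes "x \<in> P"
  shows "link_cochain P n x \<one>\<^bsub>grp K n\<^esub> = \<one>\<^bsub>grp (L x) (n - 1)\<^esub>"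
  using snoc_in_nerve[OF assms] by (auto simp: rel_one red_one red_carrier link_cochain_def fun_eq_iff)

text \<open>
  Removing \<open>x\<close> from \<open>\<tau> @ [x]\<close> leaves a simplex of \<open>Q\<close>, on which relative cochains vanish. The other
  faces still end in \<open>x\<close> and are those of \<open>\<tau>\<close> with \<open>x\<close> appended, so that no restriction map of \<open>F\<close>
  other than an identity is involved.
\<close>

lemma link_cochain_dif:
  assumes x: "x \<in> P" and s: "s \<in> carrier (grp K n)"
  shows "link_cochain P (n + 1) x (differential P F n s)
       = red_differential (strictly_above P x) (obj F x) (n - 1) (link_cochain P n x s)"
proof (cases "n < 0")
  case True
  have "differential P F n s = \<one>\<^bsub>grp K (n + 1)\<^esub>"
    using True by (simp add: differential_negative rel_one cochains_def)
  then show ?thesis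
    using True link_cochain_one[OF x, of "n + 1"] by (simp add: red_differential_low red_carrier)
next
  case False
  then have n: "0 \<le> n" by simp
  let ?U = "strictly_above P x" and ?A = "obj F x"
  have A: "comm_group ?A" by (rule presheaf_comm_group[OF presheaf x])
  interpret A: comm_group ?A by (rule A)
  have sc: "s \<in> carrier (cochains P F n)" using s by (simp add: rel_carrier_iff)
  have lc: "link_cochain P n x s \<in> carrier (red_cochains ?U ?A (n - 1))"
    using link_cochain_closed[OF x s] by (simp add: red_carrier)
  have "differential P F n s (\<tau> @ [x]) = red_differential ?U ?A (n - 1) (link_cochain P n x s) \<tau>"
    if \<tau>: "\<tau> \<in> aug_nerve ?U n" for \<tau>
  proof -
    have \<sigma>: "\<tau> @ [x] \<in> nerve P (n + 1)" using snoc_in_nerve[OF x, of \<tau> "n + 1"] \<tau> by simp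
    have f: "face i \<tau> \<in> aug_nerve ?U (n - 1)" if "i < length \<tau>" for i
      using face_in_aug_nerve[of \<tau> ?U "n - 1" i] \<tau> that by simp
    have front: "transported_face F s (\<tau> @ [x]) i = link_cochain P n x s (face i \<tau>)"
      if "i < length \<tau>" for i
      using transported_face_same_last[OF presheaf sc \<sigma> _ n, of i] f that
      by (simp add: face_snoc link_cochain_def)
    have "transported_face F s (\<tau> @ [x]) (length \<tau>) = \<one>\<^bsub>obj F (last (\<tau> @ [x]))\<^esub>"
    proof (rule transported_face_one[OF presheaf \<sigma> _ n])
      have "\<tau> \<noteq> []" using \<tau> n by (auto simp: aug_nerve_iff)
      then have "last \<tau> \<in> ?U" using \<tau> last_in_set by (fastforce simp: aug_nerve_iff)
      moreover have "\<tau> \<in> nerve P n" using face_in_nerve[OF \<sigma> _ n, of "length \<tau>"]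
        by (simp add: face_length_snoc)
      ultimately show "s (face (length \<tau>) (\<tau> @ [x]))
          = \<one>\<^bsub>obj F (last (face (length \<tau>) (\<tau> @ [x])))\<^esub>"
        using rel_cochain_one[OF s] above_in_Q[OF x]
        by (simp add: face_length_snoc strictly_above_def)
    qed simp
    moreover have "alternating_prod ?A (length \<tau>) (transported_face F s (\<tau> @ [x]))
        = alternating_prod ?A (length \<tau>) (\<lambda>i. link_cochain P n x s (face i \<tau>))"
      by (rule alternating_prod_cong) (rule front)
    moreover have "alternating_prod ?A (length \<tau>) (\<lambda>i. link_cochain P n x s (face i \<tau>)) \<in> carrier ?A"
      using lc f by (intro A.alternating_prod_closed) (auto simp: red_cochains_carrier_iff)
    ultimately show ?thesis
      using red_differential_eq_alternating_prod[OF A lc, of \<tau>] \<tau> n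
      by (simp add: differential_eq_alternating_prod[OF presheaf sc \<sigma> n])
  qed
  then show ?thesis
    using red_differential_extensional[of ?U ?A "n - 1"]
    by (auto simp: link_cochain_def fun_eq_iff extensional_def)
qed

lemma link_cochain_coboundaries:
  "x \<in> P \<Longrightarrow> link_cochain P n x ` coboundaries K n \<subseteq> coboundaries (L x) (n - 1)"
  using link_cochain_dif[of x _ "n - 1"]
  by (intro K.coboundaries_image[where g = "link_cochain P (n - 1) x"] link_cochain_closed)
    (simp_all add: rel_dif red_dif)

lemma link_cochain_cocycles:
  assumes x: "x \<in> P" and s: "s \<in> cocycles K n"
  shows "link_cochain P n x s \<in> cocycles (L x) (n - 1)"
  using s link_cochain_closed[OF x K.cocycles_carrier[OF s]]
    link_cochain_dif[OF x K.cocycles_carrier[OF s]] link_cochain_one[OF x, of "n + 1"]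
  by (simp add: cocycles_def kernel_def rel_dif red_dif)

lemma cone_cochain_closed:
  assumes "\<And>x. x \<in> P - Q \<Longrightarrow> t x \<in> carrier (grp (L x) (n - 1))"
  shows "cone_cochain P Q F n t \<in> carrier (grp K n)"
proof -
  have "cone_cochain P Q F n t \<sigma> \<in> carrier (obj F (last \<sigma>))" if \<sigma>: "\<sigma> \<in> nerve P n" for \<sigma>
  proof -
    interpret A: comm_group "obj F (last \<sigma>)"
      by (rule presheaf_comm_group[OF presheaf last_in_poset[OF \<sigma>]])
    have "butlast \<sigma> @ [last \<sigma>] \<in> nerve P n" using \<sigma> by (simp add: nerve_def)
    from butlast_in_link[OF this] show ?thesis
      using assms[of "last \<sigma>"] last_in_poset[OF \<sigma>] \<sigma>
      by (auto simp: cone_cochain_def red_carrier red_cochains_carrier_iff)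
  qed
  moreover have "cone_cochain P Q F n t \<sigma> = \<one>\<^bsub>obj F (last \<sigma>)\<^esub>" if "\<sigma> \<in> nerve Q n" for \<sigma>
    using that nerve_mono[OF Q_subset] last_in_poset[OF that] by (auto simp: cone_cochain_def)
  ultimately show ?thesis
    by (auto simp: rel_carrier_iff cochains_carrier_iff cone_cochain_def)
qed

lemma link_cone:
  assumes x: "x \<in> P - Q" and t: "t x \<in> carrier (grp (L x) (n - 1))"
  shows "link_cochain P n x (cone_cochain P Q F n t) = t x"
proof
  fix \<tau>
  show "link_cochain P n x (cone_cochain P Q F n t) \<tau> = t x \<tau>"
  proof (cases "\<tau> \<in> aug_nerve (strictly_above P x) (n - 1)")
    case True
    then have "x \<notin> set \<tau>" by (auto simp: aug_nerve_iff strictly_above_def)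
    then show ?thesis
      using True x snoc_in_nerve[of x P \<tau> n] by (simp add: link_cochain_def cone_cochain_def)
  next
    case False
    then show ?thesis
      using t by (simp add: link_cochain_def red_carrier red_cochains_carrier_iff extensional_def)
  qed
qed

text \<open>
  On simplices that end in \<open>x\<close> once, this is the computation for the maps to links. If \<open>x\<close> is
  repeated, the right-hand side vanishes; on the left, deleting one of the last two vertices gives
  the same simplex twice with opposite signs, and deleting any earlier vertex leaves a simplex that
  still ends in \<open>x\<close> at least twice, on which the cone vanishes.
\<close>

lemma cone_cochain_dif:
  assumes n: "0 \<le> n" and t: "\<And>x. x \<in> P - Q \<Longrightarrow> t x \<in> carrier (grp (L x) (n - 1))"
  shows "differential P F n (cone_cochain P Q F n t)
    = cone_cochain P Q F (n + 1) (\<lambda>x. red_differential (strictly_above P x) (obj F x) (n - 1) (t x))"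
    (is "differential P F n ?c = cone_cochain P Q F (n + 1) ?dt")
proof
  fix \<sigma>
  have c: "?c \<in> carrier (grp K n)" by (rule cone_cochain_closed[OF t])
  then have cc: "?c \<in> carrier (cochains P F n)" by (simp add: rel_carrier_iff)
  show "differential P F n ?c \<sigma> = cone_cochain P Q F (n + 1) ?dt \<sigma>"
  proof (cases "\<sigma> \<in> nerve P (n + 1)")
    case False
    then show ?thesis
      using differential_extensional[of P F n ?c] by (simp add: cone_cochain_def extensional_def)
  next
    case \<sigma>: True
    define x \<tau> where "x = last \<sigma>" and "\<tau> = butlast \<sigma>"
    have \<sigma>_eq: "\<sigma> = \<tau> @ [x]" using \<sigma> by (simp add: x_def \<tau>_def nerve_def)
    note \<sigma>' = \<sigma>[unfolded \<sigma>_eq]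
    have x: "x \<in> P" using last_in_poset[OF \<sigma>] by (simp add: x_def)
    have A: "comm_group (obj F x)" by (rule presheaf_comm_group[OF presheaf x])
    interpret A: comm_group "obj F x" by (rule A)
    have \<tau>: "\<tau> \<in> nerve P n"
      using face_in_nerve[OF \<sigma>' _ n, of "length \<tau>"] by (simp add: face_length_snoc)
    then have ne: "\<tau> \<noteq> []" by (simp add: nerve_def)
    have dc: "differential P F n ?c \<sigma>
        = alternating_prod (obj F x) (Suc (length \<tau>)) (transported_face F ?c (\<tau> @ [x]))"
      using differential_eq_alternating_prod[OF presheaf cc \<sigma> n] by (simp add: \<sigma>_eq)
    have front: "transported_face F ?c (\<tau> @ [x]) i = ?c (face i \<tau> @ [x])" if "i < length \<tau>" for i
      using transported_face_same_last[OF presheaf cc \<sigma>' _ n, of i] that by (simp add: face_snoc)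
    have front_nerve: "face i \<tau> @ [x] \<in> nerve P n" if "i < length \<tau>" for i
      using face_in_nerve[OF \<sigma>' _ n, of i] that by (simp add: face_snoc)
    consider "x \<in> Q" | "x \<notin> Q" "x \<notin> set \<tau>" | "x \<in> set \<tau>" by blast
    then show ?thesis
    proof cases
      case 1
      then show ?thesis
        using rel_cochain_one[OF dif_closed[OF c] \<sigma>] \<sigma> by (simp add: cone_cochain_def x_def)
    next
      case 2
      have link: "\<tau> \<in> aug_nerve (strictly_above P x) n"
        using butlast_in_link[OF \<sigma>' 2(2)] by simp
      have tx: "t x \<in> carrier (red_cochains (strictly_above P x) (obj F x) (n - 1))"
        using t[of x] x 2 by (simp add: red_carrier)
      have tf: "t x (face i \<tau>) \<in> carrier (obj F x)" if "i < length \<tau>" for i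
        using face_in_aug_nerve[of \<tau> "strictly_above P x" "n - 1" i] link tx that
        by (simp add: red_cochains_carrier_iff)
      have "transported_face F ?c (\<tau> @ [x]) (length \<tau>) = \<one>\<^bsub>obj F (last (\<tau> @ [x]))\<^esub>"
      proof (rule transported_face_one[OF presheaf \<sigma>' _ n])
        have "last \<tau> \<in> strictly_above P x"
          using link ne last_in_set by (fastforce simp: aug_nerve_iff)
        then have "last \<tau> \<in> Q" using above_in_Q[OF x] by (simp add: strictly_above_def)
        then show "?c (face (length \<tau>) (\<tau> @ [x])) = \<one>\<^bsub>obj F (last (face (length \<tau>) (\<tau> @ [x])))\<^esub>"
          using rel_cochain_one[OF c \<tau>] by (simp add: face_length_snoc)
      qed simp
      moreover have "alternating_prod (obj F x) (length \<tau>) (transported_face F ?c (\<tau> @ [x]))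
          = alternating_prod (obj F x) (length \<tau>) (\<lambda>i. t x (face i \<tau>))"
      proof (rule alternating_prod_cong)
        fix i assume i: "i < length \<tau>"
        have "x \<notin> set (face i \<tau>)" using 2 face_subset[of i \<tau>] by blast
        then show "transported_face F ?c (\<tau> @ [x]) i = t x (face i \<tau>)"
          using front[OF i] front_nerve[OF i] 2 by (simp add: cone_cochain_def)
      qed
      ultimately show ?thesis
        unfolding dc
        using red_differential_eq_alternating_prod[OF A tx, of \<tau>] link n \<sigma> 2
          A.alternating_prod_closed[OF tf]
        by (simp add: cone_cochain_def flip: x_def \<tau>_def)
    next
      case 3
      have "last \<tau> \<le> x" using last_le[OF \<tau> 3] .
      moreover have "x \<le> last \<tau>"
        using last_le[OF \<sigma>', of "last \<tau>"] ne by simp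
      ultimately have "last \<tau> = x" by simp
      then obtain \<rho> where \<rho>: "\<tau> = \<rho> @ [x]" using ne by (metis append_butlast_last_id)
      have "alternating_prod (obj F x) (Suc (Suc (length \<rho>))) (transported_face F ?c (\<tau> @ [x]))
          = \<one>\<^bsub>obj F x\<^esub>"
      proof (rule A.alternating_prod_cancel)
        fix i assume i: "i < length \<rho>"
        then have "x \<in> set (face i \<tau>)" by (simp add: \<rho> face_snoc)
        then show "transported_face F ?c (\<tau> @ [x]) i = \<one>\<^bsub>obj F x\<^esub>"
          using front[of i] front_nerve[of i] i by (simp add: \<rho> cone_cochain_def)
      next
        have "face (Suc (length \<rho>)) (\<tau> @ [x]) = face (length \<rho>) (\<tau> @ [x])"
          using face_length_snoc[of \<tau> x] face_snoc[of "length \<rho>" \<tau> x]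
          by (simp add: \<rho> face_length_snoc)
        then show "transported_face F ?c (\<tau> @ [x]) (Suc (length \<rho>))
            = transported_face F ?c (\<tau> @ [x]) (length \<rho>)"
          by (simp add: transported_face_def)
      next
        show "transported_face F ?c (\<tau> @ [x]) (length \<rho>) \<in> carrier (obj F x)"
          using transported_face_closed[OF presheaf cc \<sigma>' _ n, of "length \<rho>"] by (simp add: \<rho>)
      qed
      then show ?thesis
        unfolding dc using \<sigma> 3 by (simp add: \<rho> cone_cochain_def flip: x_def \<tau>_def)
    qed
  qed
qed

text \<open>
  The contraction repeats the last vertex: put \<open>u \<rho> = s (\<rho> @ [last \<rho>])\<close>. For a simplex \<open>\<sigma>\<close> that ends
  in \<open>x \<in> P - Q\<close>, the equation \<open>ds = 0\<close> at \<open>\<sigma> @ [x]\<close> says that \<open>du\<close> at \<open>\<sigma>\<close> equals \<open>s \<sigma>\<close> up to sign, since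
  \<open>\<sigma>\<close> is the last face of \<open>\<sigma> @ [x]\<close>. This uses that the face of \<open>\<sigma>\<close> which no longer ends in \<open>x\<close>,
  if there is one, contributes to neither side: \<open>u\<close> vanishes on it because it lies in \<open>Q\<close>, and \<open>s\<close>
  vanishes on it with \<open>x\<close> appended because \<open>s\<close> maps to zero in the link of \<open>x\<close>. In degree \<open>0\<close> there
  is no room for \<open>u\<close>, but there \<open>s\<close> is itself determined by its values at the elements of
  \<open>P - Q\<close>, which are its images in the links.
\<close>

lemma link_kernel_acyclic:
  assumes n: "0 \<le> n" and s: "s \<in> cocycles K n"
    and link: "\<And>x. x \<in> P - Q \<Longrightarrow> link_cochain P n x s = \<one>\<^bsub>grp (L x) (n - 1)\<^esub>"
  shows "s \<in> coboundaries K n"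
proof -
  interpret G: comm_group "grp K n" by (rule K.comm_group_grp)
  have sK: "s \<in> carrier (grp K n)" by (rule K.cocycles_carrier[OF s])
  then have sc: "s \<in> carrier (cochains P F n)" by (simp add: rel_carrier_iff)
  have ds: "differential P F n s = \<one>\<^bsub>grp K (n + 1)\<^esub>"
    using s by (simp add: cocycles_def kernel_def rel_dif)
  have s_link: "s (\<tau> @ [x]) = \<one>\<^bsub>obj F x\<^esub>"
    if "x \<in> P - Q" "\<tau> \<in> aug_nerve (strictly_above P x) (n - 1)" for x \<tau>
    using fun_cong[OF link[OF that(1)], of \<tau>] that(2)
    by (simp add: link_cochain_def red_carrier red_one)
  show ?thesis
  proof (cases "n = 0")
    case True
    have "s \<sigma> = \<one>\<^bsub>obj F (last \<sigma>)\<^esub>" if \<sigma>: "\<sigma> \<in> nerve P n" for \<sigma>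
    proof (cases "last \<sigma> \<in> Q")
      case False
      obtain x where x: "\<sigma> = [x]" using \<sigma> True by (auto simp: nerve_def length_Suc_conv)
      then have "[] @ [x] \<in> nerve P n" using \<sigma> by simp
      then show ?thesis
        using s_link[of x "[]"] False last_in_poset[OF \<sigma>] True by (simp add: x aug_nerve_iff)
    qed (rule rel_cochain_one[OF sK \<sigma>])
    then have "s = \<one>\<^bsub>grp K n\<^esub>"
      using sc by (auto simp: rel_one cochains_carrier_iff extensional_def fun_eq_iff)
    then show ?thesis using subgroup.one_closed[OF K.coboundaries_subgroup] by simp
  next
    case False
    then have n': "0 \<le> n - 1" using n by simp
    define u where "u = (\<lambda>\<rho>\<in>nerve P (n - 1). s (\<rho> @ [last \<rho>]))"
    have snoc: "\<sigma> @ [last \<sigma>] \<in> nerve P (m + 1)" if "\<sigma> \<in> nerve P m" for \<sigma> m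
      using that last_le[OF that] by (auto simp: nerve_def sorted_wrt_append)
    have snoc': "\<rho> @ [last \<rho>] \<in> nerve P n" if "\<rho> \<in> nerve P (n - 1)" for \<rho>
      using snoc[OF that] by simp
    have u_one: "u \<rho> = \<one>\<^bsub>obj F (last \<rho>)\<^esub>" if "\<rho> \<in> nerve P (n - 1)" "last \<rho> \<in> Q" for \<rho>
      using rel_cochain_one[OF sK snoc'[OF that(1)]] that by (simp add: u_def)
    have uK: "u \<in> carrier (grp K (n - 1))"
      using snoc' sc u_one nerve_mono[OF Q_subset] last_in_poset
      by (force simp: u_def rel_carrier_iff cochains_carrier_iff)
    then have uc: "u \<in> carrier (cochains P F (n - 1))" by (simp add: rel_carrier_iff)
    let ?du = "differential P F (n - 1) u"
    have duK: "?du \<in> carrier (grp K n)" using dif_closed[OF uK] by simp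
    \<comment> \<open>The sign of \<open>s \<sigma>\<close> is that of the last face of \<open>\<sigma> @ [last \<sigma>]\<close>, which has index \<open>length \<sigma>\<close>.\<close>
    have key: "?du \<sigma> \<otimes>\<^bsub>obj F (last \<sigma>)\<^esub> s \<sigma> [^]\<^bsub>obj F (last \<sigma>)\<^esub> ((-1) ^ length \<sigma> :: int)
        = \<one>\<^bsub>obj F (last \<sigma>)\<^esub>" if \<sigma>: "\<sigma> \<in> nerve P n" for \<sigma>
    proof -
      define x where "x = last \<sigma>"
      have x: "x \<in> P" using last_in_poset[OF \<sigma>] by (simp add: x_def)
      interpret A: comm_group "obj F x" by (rule presheaf_comm_group[OF presheaf x])
      show ?thesis
      proof (cases "x \<in> Q")
        case True
        then show ?thesis
          using rel_cochain_one[OF sK \<sigma>] rel_cochain_one[OF duK \<sigma>] by (simp flip: x_def)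
      next
        case xQ: False
        have \<sigma>x: "\<sigma> @ [x] \<in> nerve P (n + 1)" using snoc[OF \<sigma>] by (simp add: x_def)
        have \<sigma>1: "\<sigma> \<in> nerve P (n - 1 + 1)" using \<sigma> by simp
        have "transported_face F s (\<sigma> @ [x]) i = transported_face F u \<sigma> i" if i: "i < length \<sigma>" for i
        proof -
          have f: "face i \<sigma> \<in> nerve P (n - 1)" by (rule face_in_nerve[OF \<sigma>1 i n'])
          have l: "transported_face F s (\<sigma> @ [x]) i = s (face i \<sigma> @ [x])"
            using transported_face_same_last[OF presheaf sc \<sigma>x _ n, of i] i by (simp add: face_snoc)
          show ?thesis
          proof (cases "last (face i \<sigma>) = x")
            case True
            then show ?thesis
              using transported_face_same_last[OF presheaf uc \<sigma>1 i n'] f l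
              by (simp add: u_def flip: x_def)
          next
            case False
            then have less: "x < last (face i \<sigma>)"
              using last_le_last_face[OF \<sigma>1 i n'] by (simp flip: x_def)
            then have "last (face i \<sigma>) \<in> Q" using above_in_Q[OF x last_in_poset[OF f]] by simp
            then have "transported_face F u \<sigma> i = \<one>\<^bsub>obj F x\<^esub>"
              using transported_face_one[where s = u, OF presheaf \<sigma>1 i n'] u_one[OF f]
              by (simp flip: x_def)
            then show ?thesis using l s_link[OF _ nerve_above[OF f less]] x xQ by simp
          qed
        qed
        then have "alternating_prod (obj F x) (length \<sigma>) (transported_face F s (\<sigma> @ [x])) = ?du \<sigma>"
          unfolding differential_eq_alternating_prod[OF presheaf uc \<sigma>1 n'] x_def[symmetric]
          by (rule alternating_prod_cong)
        moreover have "transported_face F s (\<sigma> @ [x]) (length \<sigma>) = s \<sigma>"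
          using transported_face_same_last[OF presheaf sc \<sigma>x _ n, of "length \<sigma>"]
          by (simp add: face_length_snoc x_def)
        moreover have "differential P F n s (\<sigma> @ [x]) = \<one>\<^bsub>obj F x\<^esub>"
          using \<sigma>x by (simp add: ds rel_one)
        ultimately show ?thesis
          using differential_eq_alternating_prod[OF presheaf sc \<sigma>x n] by (simp flip: x_def)
      qed
    qed
    have du: "?du \<in> coboundaries K n" using uK by (auto simp: coboundaries_def rel_dif)
    have len: "length \<sigma> = Suc (nat n)" if "\<sigma> \<in> nerve P n" for \<sigma>
      using that n by (simp add: nerve_def) linarith
    have s\<sigma>: "s \<sigma> \<in> carrier (obj F (last \<sigma>))" "?du \<sigma> \<in> carrier (obj F (last \<sigma>))"
      and grp: "group (obj F (last \<sigma>))" if "\<sigma> \<in> nerve P n" for \<sigma>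
      using that sc duK presheaf_comm_group[OF presheaf last_in_poset[OF that]]
      by (simp_all add: rel_carrier_iff cochains_carrier_iff comm_group.axioms(2))
    show ?thesis
    proof (cases "even (nat n)")
      case True
      have "?du \<sigma> = s \<sigma>" if \<sigma>: "\<sigma> \<in> nerve P n" for \<sigma>
      proof -
        interpret A: group "obj F (last \<sigma>)" by (rule grp[OF \<sigma>])
        have "?du \<sigma> \<otimes>\<^bsub>obj F (last \<sigma>)\<^esub> inv\<^bsub>obj F (last \<sigma>)\<^esub> s \<sigma> = \<one>\<^bsub>obj F (last \<sigma>)\<^esub>"
          using key[OF \<sigma>] True s\<sigma>[OF \<sigma>] by (simp add: len[OF \<sigma>] A.int_pow_neg)
        then show ?thesis using s\<sigma>[OF \<sigma>] A.inv_solve_right' A.one_closed by fastforce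
      qed
      moreover have "s \<in> extensional (nerve P n)" "?du \<in> extensional (nerve P n)"
        using sc duK by (auto simp: rel_carrier_iff cochains_carrier_iff)
      ultimately have "?du = s" by (intro extensionalityI)
      then show ?thesis using du by simp
    next
      case False
      have "?du \<sigma> \<otimes>\<^bsub>obj F (last \<sigma>)\<^esub> s \<sigma> = \<one>\<^bsub>obj F (last \<sigma>)\<^esub>" if \<sigma>: "\<sigma> \<in> nerve P n" for \<sigma>
      proof -
        interpret A: group "obj F (last \<sigma>)" by (rule grp[OF \<sigma>])
        show ?thesis using key[OF \<sigma>] False s\<sigma>[OF \<sigma>] by (simp add: len[OF \<sigma>])
      qed
      then have "?du \<otimes>\<^bsub>grp K n\<^esub> s = \<one>\<^bsub>grp K n\<^esub>" by (auto simp: rel_mult rel_one fun_eq_iff)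
      then have "inv\<^bsub>grp K n\<^esub> ?du = s" using G.inv_equality G.m_comm sK duK by metis
      then show ?thesis using subgroup.m_inv_closed[OF K.coboundaries_subgroup du] by simp
    qed
  qed
qed

lemma cone_cochain_cocycle:
  assumes n: "0 \<le> n" and t: "\<And>x. x \<in> P - Q \<Longrightarrow> t x \<in> cocycles (L x) (n - 1)"
  shows "cone_cochain P Q F n t \<in> cocycles K n"
proof -
  have tc: "t x \<in> carrier (grp (L x) (n - 1))"
    and dt: "red_differential (strictly_above P x) (obj F x) (n - 1) (t x) = \<one>\<^bsub>grp (L x) n\<^esub>"
    if "x \<in> P - Q" for x
    using t[OF that] by (simp_all add: cocycles_def kernel_def red_dif)
  have "differential P F n (cone_cochain P Q F n t) \<sigma> = \<one>\<^bsub>obj F (last \<sigma>)\<^esub>"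
    if \<sigma>: "\<sigma> \<in> nerve P (n + 1)" for \<sigma>
  proof (cases "last \<sigma> \<in> Q \<or> last \<sigma> \<in> set (butlast \<sigma>)")
    case True
    then show ?thesis
      using \<sigma> by (subst cone_cochain_dif[OF n tc]) (auto simp: cone_cochain_def)
  next
    case False
    have "butlast \<sigma> @ [last \<sigma>] \<in> nerve P (n + 1)" using \<sigma> by (simp add: nerve_def)
    then have "butlast \<sigma> \<in> aug_nerve (strictly_above P (last \<sigma>)) n"
      using butlast_in_link False by fastforce
    then show ?thesis
      using \<sigma> False dt[of "last \<sigma>"] last_in_poset[OF \<sigma>]
      by (subst cone_cochain_dif[OF n tc]) (auto simp: cone_cochain_def red_carrier red_one)
  qed
  then have "differential P F n (cone_cochain P Q F n t) = \<one>\<^bsub>grp K (n + 1)\<^esub>"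
    using differential_extensional[of P F n "cone_cochain P Q F n t"]
    by (auto simp: rel_one fun_eq_iff extensional_def)
  then show ?thesis
    using cone_cochain_closed[OF tc] by (simp add: cocycles_def kernel_def rel_dif)
qed

text \<open>
  Subtracting from \<open>s\<close> the cone over its images in the links moves it into the kernel of the maps to
  links. That cone is a coboundary: if the images are the coboundaries of \<open>t\<close>, it is the coboundary
  of the cone over \<open>t\<close>.
\<close>

lemma link_reflects_coboundaries:
  assumes n: "0 \<le> n" and s: "s \<in> cocycles K n"
    and B: "\<And>x. x \<in> P - Q \<Longrightarrow> link_cochain P n x s \<in> coboundaries (L x) (n - 1)"
  shows "s \<in> coboundaries K n"
proof -
  interpret G: comm_group "grp K n" by (rule K.comm_group_grp)
  have sK: "s \<in> carrier (grp K n)" by (rule K.cocycles_carrier[OF s])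
  have "\<forall>x\<in>P - Q. \<exists>t\<in>carrier (grp (L x) (n - 2)).
      link_cochain P n x s = red_differential (strictly_above P x) (obj F x) (n - 2) t"
    using B by (fastforce simp: coboundaries_def red_dif)
  then obtain t where t: "\<And>x. x \<in> P - Q \<Longrightarrow> t x \<in> carrier (grp (L x) (n - 2))"
    and dt: "\<And>x. x \<in> P - Q \<Longrightarrow>
      link_cochain P n x s = red_differential (strictly_above P x) (obj F x) (n - 2) (t x)"
    by metis
  show ?thesis
  proof (cases "n = 0")
    case True
    have "link_cochain P n x s = \<one>\<^bsub>grp (L x) (n - 1)\<^esub>" if "x \<in> P - Q" for x
      unfolding dt[OF that] using True by (simp add: red_differential_low red_carrier)
    then show ?thesis by (rule link_kernel_acyclic[OF n s])
  next
    case False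
    then have n': "0 \<le> n - 1" using n by simp
    define v where "v = cone_cochain P Q F n (\<lambda>x. link_cochain P n x s)"
    have vZ: "v \<in> cocycles K n"
      unfolding v_def by (rule cone_cochain_cocycle[OF n link_cochain_cocycles[OF _ s]]) simp
    then have vK: "v \<in> carrier (grp K n)" by (rule K.cocycles_carrier)
    have t': "\<And>x. x \<in> P - Q \<Longrightarrow> t x \<in> carrier (grp (L x) (n - 1 - 1))" using t by simp
    have "v = cone_cochain P Q F n
        (\<lambda>x. red_differential (strictly_above P x) (obj F x) (n - 2) (t x))"
      unfolding v_def cone_cochain_def using dt last_in_poset[of _ P n] by (intro restrict_ext) auto
    moreover have "differential P F (n - 1) (cone_cochain P Q F (n - 1) t) = \<dots>"
      using cone_cochain_dif[OF n', of t] t' by simp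
    ultimately have "v = differential P F (n - 1) (cone_cochain P Q F (n - 1) t)" by simp
    then have vB: "v \<in> coboundaries K n"
      using cone_cochain_closed[OF t'] by (auto simp: coboundaries_def rel_dif)
    let ?w = "s \<otimes>\<^bsub>grp K n\<^esub> inv\<^bsub>grp K n\<^esub> v"
    have wZ: "?w \<in> cocycles K n"
      by (rule subgroup.m_closed[OF K.cocycles_subgroup s
            subgroup.m_inv_closed[OF K.cocycles_subgroup vZ]])
    have "link_cochain P n x ?w = \<one>\<^bsub>grp (L x) (n - 1)\<^esub>" if x: "x \<in> P - Q" for x
    proof -
      interpret L: group_sequence "L x" using x by (intro L_group_sequence) simp
      interpret h: group_hom "grp K n" "grp (L x) (n - 1)" "link_cochain P n x"
        using x L.comm_group_grp[of "n - 1"] link_cochain_hom[of x n]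
        by (simp add: group_hom_def group_hom_axioms_def comm_group.axioms(2) G.is_group)
      have "link_cochain P n x v = link_cochain P n x s"
        unfolding v_def by (rule link_cone[OF x]) (use x sK in \<open>simp add: link_cochain_closed\<close>)
      moreover have "link_cochain P n x s \<in> carrier (grp (L x) (n - 1))"
        using x sK by (simp add: link_cochain_closed)
      ultimately show ?thesis using sK vK by (simp add: h.H.r_inv)
    qed
    then have "?w \<in> coboundaries K n" by (rule link_kernel_acyclic[OF n wZ])
    then have "?w \<otimes>\<^bsub>grp K n\<^esub> v \<in> coboundaries K n"
      by (rule subgroup.m_closed[OF K.coboundaries_subgroup _ vB])
    then show ?thesis using sK vK by (simp add: G.m_assoc)
  qed
qed

lemma link_map_class:
  assumes "x \<in> P - Q" "s \<in> carrier (grp K n)"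
  shows "link_map P Q F n (cohomology_class K n s) x
       = cohomology_class (L x) (n - 1) (link_cochain P n x s)"
proof -
  have x: "x \<in> P" using assms(1) by simp
  show ?thesis
    using K.cohomology_map_class[OF L_group_sequence[OF x] link_cochain_hom[OF x]
        link_cochain_coboundaries[OF x] assms(2)] assms(1)
    by (simp only: link_map_def restrict_apply if_True)
qed

lemma link_map_iso:
  assumes n: "0 \<le> n"
  shows "link_map P Q F n \<in> iso (cohomology K n) (product_group (P - Q) (\<lambda>x. cohomology (L x) (n - 1)))"
  unfolding link_map_def[abs_def]
proof (rule K.cohomology_product_iso)
  fix t assume t: "\<And>x. x \<in> P - Q \<Longrightarrow> t x \<in> cocycles (L x) (n - 1)"
  have "link_cochain P n x (cone_cochain P Q F n t) = t x" if "x \<in> P - Q" for x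
    using link_cone[where t = t, OF that] t[OF that]
    by (simp add: cocycles_def kernel_def)
  then show "\<exists>z\<in>cocycles K n. \<forall>x\<in>P - Q. link_cochain P n x z = t x"
    using cone_cochain_cocycle[OF n t] by blast
next
  fix x assume "x \<in> P - Q"
  then have x: "x \<in> P" by simp
  show "group_sequence (L x)" by (rule L_group_sequence[OF x])
  show "link_cochain P n x \<in> hom (grp K n) (grp (L x) (n - 1))" by (rule link_cochain_hom[OF x])
  show "link_cochain P n x ` coboundaries K n \<subseteq> coboundaries (L x) (n - 1)"
    by (rule link_cochain_coboundaries[OF x])
  fix z assume "z \<in> cocycles K n"
  then show "link_cochain P n x z \<in> cocycles (L x) (n - 1)" by (rule link_cochain_cocycles[OF x])
qed (rule link_reflects_coboundaries[OF n])

end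

text \<open>
  A morphism of presheaves acts on the values of cochains and the maps to links only select
  arguments, so the two commute already on cochains.
\<close>

lemma link_map_natural:
  fixes F G :: "('a::order, 'b) presheaf"
  assumes F: "minimal_complement P Q F" and G: "minimal_complement P Q G"
    and \<phi>: "presheaf_hom P F G \<phi>"
    and c: "c \<in> carrier (rel_cohomology P Q F n)"
  shows "link_map P Q G n (rel_cohomology_map P Q G n \<phi> c)
       = (\<lambda>x\<in>P - Q. red_cohomology_map (strictly_above P x) (obj G x) (n - 1) (\<phi> x)
                        (link_map P Q F n c x))"
proof
  fix x
  interpret F: minimal_complement P Q F by (rule F)
  interpret G: minimal_complement P Q G by (rule G)
  obtain s where s: "s \<in> carrier (grp F.K n)" and cs: "c = cohomology_class F.K n s"
    using c unfolding F.K.carrier_cohomology by (blast dest: F.K.cocycles_carrier)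
  have push: "rel_push P n \<phi> s \<in> carrier (grp G.K n)"
    by (rule rel_push_closed[OF F.presheaf G.presheaf \<phi> F.Q_subset s])
  show "link_map P Q G n (rel_cohomology_map P Q G n \<phi> c) x
      = (\<lambda>x\<in>P - Q. red_cohomology_map (strictly_above P x) (obj G x) (n - 1) (\<phi> x)
                       (link_map P Q F n c x)) x"
  proof (cases "x \<in> P - Q")
    case x: True
    then have xP: "x \<in> P" by simp
    have "link_cochain P n x (rel_push P n \<phi> s)
        = red_push (strictly_above P x) (n - 1) (\<phi> x) (link_cochain P n x s)"
      using snoc_in_nerve[OF xP] by (auto simp: link_cochain_def rel_push_def red_push_def fun_eq_iff)
    moreover have "red_cohomology_map (strictly_above P x) (obj G x) (n - 1) (\<phi> x)
          (cohomology_class (F.L x) (n - 1) (link_cochain P n x s))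
        = cohomology_class (G.L x) (n - 1)
            (red_push (strictly_above P x) (n - 1) (\<phi> x) (link_cochain P n x s))"
    proof (rule red_cohomology_map_class)
      show "\<phi> x \<in> hom (obj F x) (obj G x)" using \<phi> xP by (simp add: presheaf_hom_def)
      show "link_cochain P n x s \<in> carrier (red_cochains (strictly_above P x) (obj F x) (n - 1))"
        using F.link_cochain_closed[OF xP s] by (simp add: red_carrier)
    qed (rule presheaf_comm_group[OF F.presheaf xP] presheaf_comm_group[OF G.presheaf xP])+
    ultimately show ?thesis
      using x by (simp add: cs F.link_map_class[OF x s] G.link_map_class[OF x push]
          rel_cohomology_map_class[OF F.presheaf G.presheaf \<phi> F.Q_subset s])
  next
    case False
    then show ?thesis by (simp only: link_map_def restrict_apply if_False)
  qed
qed

section \<open>Cellular cochains\<close>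

lemma corank_antimono:
  assumes "rank_function P rk" "x \<in> P" "y \<in> P" "x < y"
  shows "corank P rk y < corank P rk x"
  using assms by (auto simp: rank_function_def corank_def)

lemma corank_le_diff:
  "corank_le P rk n - corank_le P rk (n - 1) = {x \<in> P. corank P rk x = n}"
  by (auto simp: corank_le_def)

text \<open>
  Going up strictly lowers the corank, so from the elements of corank at most \<open>n\<close> one arrives
  at corank at most \<open>n - 1\<close>.
\<close>

lemma corank_le_minimal_complement:
  assumes rk: "rank_function P rk" and F: "presheaf_on P F"
  shows "minimal_complement (corank_le P rk n) (corank_le P rk (n - 1)) F"
proof
  show "corank_le P rk (n - 1) \<subseteq> corank_le P rk n" by (auto simp: corank_le_def)
  show "presheaf_on (corank_le P rk n) F"
    by (rule presheaf_on_subset[OF F]) (auto simp: corank_le_def)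
  fix x y assume "x \<in> corank_le P rk n" "y \<in> corank_le P rk n" "x < y"
  then show "y \<in> corank_le P rk (n - 1)"
    using corank_antimono[OF rk, of x y] by (simp add: corank_le_def)
qed

lemma strictly_above_corank_le:
  assumes "rank_function P rk" "x \<in> P" "corank P rk x = n"
  shows "strictly_above (corank_le P rk n) x = strictly_above P x"
  using corank_antimono[OF assms(1,2)] assms(3)
  by (force simp: strictly_above_def corank_le_def)

lemma product_group_cong:
  "(\<And>i. i \<in> I \<Longrightarrow> G i = H i) \<Longrightarrow> product_group I G = product_group I H"
  by (auto simp: product_group_def fun_eq_iff restrict_def intro!: PiE_cong)

theorem proposition1:
  fixes P :: "'a::order set" and rk :: "'a \<Rightarrow> int" and n :: nat
  assumes "rank_function P rk"
    and "bdd_above (rk ` P)"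
  shows "\<exists>\<eta> :: ('a, 'b) presheaf \<Rightarrow> ('a list \<Rightarrow> 'b) set \<Rightarrow> ('a \<Rightarrow> ('a list \<Rightarrow> 'b) set).
     (\<forall>F. presheaf_on P F \<longrightarrow>
        \<eta> F \<in> iso (cellular_cochains P rk F (int n))
                  (product_group {x \<in> P. corank P rk x = int n}
                     (\<lambda>x. red_cohomology (strictly_above P x) (obj F x) (int n - 1)))) \<and>
     (\<forall>F G \<phi>. presheaf_on P F \<longrightarrow> presheaf_on P G \<longrightarrow> presheaf_hom P F G \<phi> \<longrightarrow>
        (\<forall>c\<in>carrier (cellular_cochains P rk F (int n)).
           \<eta> G (cellular_cochains_map P rk G (int n) \<phi> c) =
           (\<lambda>x\<in>{x \<in> P. corank P rk x = int n}.
              red_cohomology_map (strictly_above P x) (obj G x) (int n - 1) (\<phi> x) (\<eta> F c x))))"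
proof (intro exI conjI allI impI ballI)
  let ?P = "corank_le P rk (int n)" and ?Q = "corank_le P rk (int n - 1)"
  let ?\<eta> = "\<lambda>F :: ('a, 'b) presheaf. link_map ?P ?Q F (int n)"
  note rk = assms(1)
  fix F :: "('a, 'b) presheaf" assume F: "presheaf_on P F"
  interpret F: minimal_complement ?P ?Q F by (rule corank_le_minimal_complement[OF rk F])
  have "product_group (?P - ?Q) (\<lambda>x. red_cohomology (strictly_above ?P x) (obj F x) (int n - 1))
      = product_group {x \<in> P. corank P rk x = int n}
          (\<lambda>x. red_cohomology (strictly_above P x) (obj F x) (int n - 1))"
    unfolding corank_le_diff
    by (rule product_group_cong) (simp add: strictly_above_corank_le[OF rk])
  then show "?\<eta> F \<in> iso (cellular_cochains P rk F (int n))
      (product_group {x \<in> P. corank P rk x = int n}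
        (\<lambda>x. red_cohomology (strictly_above P x) (obj F x) (int n - 1)))"
    using F.link_map_iso[of "int n"] by (simp add: cellular_cochains_def)
  fix G :: "('a, 'b) presheaf" and \<phi> c
  assume G: "presheaf_on P G" and \<phi>: "presheaf_hom P F G \<phi>"
    and c: "c \<in> carrier (cellular_cochains P rk F (int n))"
  have "presheaf_hom ?P F G \<phi>"
    by (rule presheaf_hom_subset[OF \<phi>]) (auto simp: corank_le_def)
  from link_map_natural[OF F.minimal_complement_axioms corank_le_minimal_complement[OF rk G] this
      c[unfolded cellular_cochains_def]]
  show "?\<eta> G (cellular_cochains_map P rk G (int n) \<phi> c) =
      (\<lambda>x\<in>{x \<in> P. corank P rk x = int n}.
         red_cohomology_map (strictly_above P x) (obj G x) (int n - 1) (\<phi> x) (?\<eta> F c x))"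
    unfolding cellular_cochains_map_def corank_le_diff
    by (auto simp: strictly_above_corank_le[OF rk] intro!: restrict_ext)
qed

end
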